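(* Let $0<n\le m$ be integers, let $m_1,\dots,m_n$ be positive integers with $\sum_{j=1}^n m_j=m$, and let $C=(C_{ij})\in\mathbb{R}^{m\times n}$. Consider the problem $$\min_{X\in\mathcal{U}}\ \sum_{i=1}^m\sum_{j=1}^n \tfrac1m X_{ij}C_{ij},\qquad \mathcal{U}=\Big\{X\in\{0,1\}^{m\times n}:\ \sum_{j=1}^n X_{ij}=1,\ \sum_{i=1}^m X_{ij}=m_j\ \ \forall\, 1\le i\le m,\ 1\le j\le n\Big\}.$$ The modified Hungarian algorithm (described in the context, implemented with slack variables) solves this problem exactly, and its computational complexity is $\mathcal{O}(m^2n)$; that is, it terminates with a perfect pseudo-matching whose $0/1$ incidence matrix is an optimal $X\in\mathcal{U}$, after $\mathcal{O}(m^2n)$ elementary operations (arithmetic operations and comparisons on real numbers, and elementary bookkeeping steps), the implied constant being absolute.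
   Context: Graph. Let $G=(V_1\cup V_2,E)$ be the complete bipartite graph in which $V_1$ has $m$ nodes (the rows of $X$) and $V_2$ has $n$ nodes (the columns of $X$), with weights $w(i,j)=\max_{i',j'}C_{i'j'}-C_{ij}\ge 0$. Pseudo-matchings. A set of edges is a pseudo-matching if every node of $V_1$ is an endpoint of at most one of its edges and the $j$th node of $V_2$ is an endpoint of at most $m_j$ of its edges; it is perfect if these numbers are exactly $1$ and exactly $m_j$ for all nodes. A perfect pseudo-matching corresponds to the matrix $X\in\mathcal{U}$ with $X_{ij}=1$ iff the edge $(i,j)$ belongs to it. Labelings. A labeling is a function $l:V_1\cup V_2\to\mathbb{R}$; it is feasible if $l(v_1)+l(v_2)\ge w(v_1,v_2)$ for all $v_1\in V_1,v_2\in V_2$. Put $E_l=\{(v_1,v_2):l(v_1)+l(v_2)=w(v_1,v_2)\}$ and, for $S\subset V_2$, $N_l(S)=\{v_1\in V_1:(v_1,v_2)\in E_l\text{ for some }v_2\in S\}$. Status of nodes, relative to a current pseudo-matching $M$. A node of $V_1$ is pseudo-matched if it is an endpoint of an edge of $M$; the $j$th node of $V_2$ is pseudo-matched if it is an endpoint of $m_j$ edges of $M$; otherwise the node is free. A node is matched if it is an endpoint of some edge of $M$; two nodes are matched to each other if the edge joining them is in $M$. A path is pseudo-alternating if its edges alternate between $M$ and the complement of $M$, and a pseudo-alternating path is pseudo-augmenting if both its endpoints are free. Pseudo-augmenting $M$ along such a path means exchanging the status (in $M$ / not in $M$) of all edges of the path. Modified Hungarian algorithm. Initialization: set $l(v_2)=0$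 for all $v_2\in V_2$ and $l(v_1)=\max_{v_2\in V_2}w(v_1,v_2)$ for all $v_1\in V_1$; initialize a pseudo-matching $M$ in $E_l$. Step 1: If $M$ is a perfect pseudo-matching, stop and output $M$. Otherwise pick a free node $v_{\text{free}}\in V_2$, set $S=\{v_{\text{free}}\}$, $T=\emptyset$, and add to $T$ every $v_1\in V_1$ matched to $v_{\text{free}}$. Step 2: If $N_l(S)\setminus T=\emptyset$, compute $\alpha_l=\min_{v_1\in V_1\setminus T,\ v_2\in S}\{l(v_1)+l(v_2)-w(v_1,v_2)\}$ and update the labeling: $l(v)\leftarrow l(v)-\alpha_l$ for $v\in S$, $l(v)\leftarrow l(v)+\alpha_l$ for $v\in T$, other labels unchanged (this forces $N_l(S)\setminus T\ne\emptyset$). Step 3: When $N_l(S)\setminus T\neq\emptyset$, pick $v_1\in N_l(S)\setminus T$. If $v_1$ is free, there is a pseudo-augmenting path in $E_l$ from $v_{\text{free}}$ to $v_1$ (through the tree built so far); pseudo-augment $M$ along it and go to Step 1. If $v_1$ is pseudo-matched, to $z\in V_2$ say, set $S\leftarrow S\cup\{z\}$, $T\leftarrow T\cup\{v_1\}$, add to $T$ every node of $V_1$ matched to $z$, and go to Step 2. Slack implementation. The algorithm keeps track of $\mathrm{slack}_{v_1}=\min_{v_2\in S}\{l(v_1)+l(v_2)-w(v_1,v_2)\}$ for all $v_1\in V_1\setminus T$; it computes $\alpha_l$ via these slacks, updates the slacks whenever the labeling changes or a node is added to $S$, and discards $\mathrm{slack}_{v_1}$ when $v_1$ is added to $T$.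 *)

theory Defs
  imports Complex_Main
begin

text \<open>
  Rows and columns are numbered from 0: the rows are \<open>i < m\<close>, the columns are \<open>j < n\<close>.
  The column multiplicities are a function \<open>mu\<close>, and only the values of \<open>mu\<close>, \<open>C\<close> and \<open>X\<close>
  inside these ranges matter.
\<close>

section \<open>The optimization problem and pseudo-matchings\<close>

definition feasible_matrices ::
  "nat \<Rightarrow> nat \<Rightarrow> (nat \<Rightarrow> nat) \<Rightarrow> (nat \<Rightarrow> nat \<Rightarrow> real) set" where
  "feasible_matrices m n mu =
     {X. (\<forall>i<m. \<forall>j<n. X i j \<in> {0, 1}) \<and>
         (\<forall>i<m. (\<Sum>j<n. X i j) = 1) \<and>
         (\<forall>j<n. (\<Sum>i<m. X i j) = real (mu j))}"

definition objective ::
  "nat \<Rightarrow> nat \<Rightarrow> (nat \<Rightarrow> nat \<Rightarrow> real) \<Rightarrow> (nat \<Rightarrow> nat \<Rightarrow> real) \<Rightarrow> real" where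
  "objective m n C X = (\<Sum>i<m. \<Sum>j<n. (1 / real m) * X i j * C i j)"

definition optimal_matrix ::
  "nat \<Rightarrow> nat \<Rightarrow> (nat \<Rightarrow> nat) \<Rightarrow> (nat \<Rightarrow> nat \<Rightarrow> real) \<Rightarrow> (nat \<Rightarrow> nat \<Rightarrow> real) \<Rightarrow> bool" where
  "optimal_matrix m n mu C X \<longleftrightarrow>
     is_arg_min (objective m n C) (\<lambda>Y. Y \<in> feasible_matrices m n mu) X"

text \<open>The edge between the \<open>i\<close>th row node and the \<open>j\<close>th column node is the pair \<open>(i, j)\<close>.\<close>

definition pseudo_matching :: "nat \<Rightarrow> nat \<Rightarrow> (nat \<Rightarrow> nat) \<Rightarrow> (nat \<times> nat) set \<Rightarrow> bool" where
  "pseudo_matching m n mu M \<longleftrightarrow>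
     M \<subseteq> {..<m} \<times> {..<n} \<and>
     (\<forall>i<m. card {j. (i, j) \<in> M} \<le> 1) \<and>
     (\<forall>j<n. card {i. (i, j) \<in> M} \<le> mu j)"

definition perfect_pseudo_matching :: "nat \<Rightarrow> nat \<Rightarrow> (nat \<Rightarrow> nat) \<Rightarrow> (nat \<times> nat) set \<Rightarrow> bool" where
  "perfect_pseudo_matching m n mu M \<longleftrightarrow>
     pseudo_matching m n mu M \<and>
     (\<forall>i<m. card {j. (i, j) \<in> M} = 1) \<and>
     (\<forall>j<n. card {i. (i, j) \<in> M} = mu j)"

definition incidence_matrix :: "(nat \<times> nat) set \<Rightarrow> nat \<Rightarrow> nat \<Rightarrow> real" where
  "incidence_matrix M i j = (if (i, j) \<in> M then 1 else 0)"


section \<open>A language with an explicit cost for every elementary operation\<close>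

text \<open>
  The computational model is a real random access machine, programmed in a small While language.
  The store has cells for natural numbers and cells for real numbers; a cell is
  addressed by a name and a list of indices, the list being empty for a scalar variable, and of
  length 1 or 2 for an entry of a vector or of a matrix. The command \<open>Choose\<close> resolves an
  unspecified ``pick'': \<open>Choose x e\<close> stores in \<open>x\<close> an arbitrary number smaller than the value
  of \<open>e\<close>, and is stuck if there is none.
\<close>

type_synonym vname = string

datatype nexp =
    N nat
  | NRead vname "nexp list"
  | NPlus nexp nexp  (infixl \<open>+\<^sub>n\<close> 65)
  | NMinus nexp nexp  (infixl \<open>-\<^sub>n\<close> 65)

datatype rexp =
    RC real
  | RRead vname "nexp list"
  | RPlus rexp rexp  (infixl \<open>+\<^sub>r\<close> 65)
  | RMinus rexp rexp  (infixl \<open>-\<^sub>r\<close> 65)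

datatype bexp =
    NEq nexp nexp  (infix \<open>=\<^sub>n\<close> 50)
  | NLess nexp nexp  (infix \<open><\<^sub>n\<close> 50)
  | REq rexp rexp  (infix \<open>=\<^sub>r\<close> 50)
  | RLess rexp rexp  (infix \<open><\<^sub>r\<close> 50)
  | Not bexp
  | And bexp bexp
  | Or bexp bexp

datatype com =
    SKIP
  | NAssign vname "nexp list" nexp
  | RAssign vname "nexp list" rexp
  | Choose vname nexp
  | Seq com com  (\<open>_;;/ _\<close> [60, 61] 60)
  | If bexp com com  (\<open>(IF _/ THEN _/ ELSE _)\<close> [0, 0, 61] 61)
  | While bexp com  (\<open>(WHILE _/ DO _)\<close> [0, 61] 61)

record state =
  nval :: "vname \<Rightarrow> nat list \<Rightarrow> nat"
  rval :: "vname \<Rightarrow> nat list \<Rightarrow> real"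

fun neval :: "nexp \<Rightarrow> state \<Rightarrow> nat" where
  "neval (N k) s = k"
| "neval (NRead x es) s = nval s x (map (\<lambda>e. neval e s) es)"
| "neval (a +\<^sub>n b) s = neval a s + neval b s"
| "neval (a -\<^sub>n b) s = neval a s - neval b s"

fun reval :: "rexp \<Rightarrow> state \<Rightarrow> real" where
  "reval (RC c) s = c"
| "reval (RRead x es) s = rval s x (map (\<lambda>e. neval e s) es)"
| "reval (a +\<^sub>r b) s = reval a s + reval b s"
| "reval (a -\<^sub>r b) s = reval a s - reval b s"

fun beval :: "bexp \<Rightarrow> state \<Rightarrow> bool" where
  "beval (a =\<^sub>n b) s \<longleftrightarrow> neval a s = neval b s"
| "beval (a <\<^sub>n b) s \<longleftrightarrow> neval a s < neval b s"
| "beval (c =\<^sub>r d) s \<longleftrightarrow> reval c s = reval d s"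
| "beval (c <\<^sub>r d) s \<longleftrightarrow> reval c s < reval d s"
| "beval (Not p) s \<longleftrightarrow> \<not> beval p s"
| "beval (And p q) s \<longleftrightarrow> beval p s \<and> beval q s"
| "beval (Or p q) s \<longleftrightarrow> beval p s \<or> beval q s"

text \<open>Evaluating an expression costs one unit per constant, memory access and operator in it.\<close>

fun ncost :: "nexp \<Rightarrow> nat" where
  "ncost (N k) = 1"
| "ncost (NRead x es) = 1 + sum_list (map ncost es)"
| "ncost (a +\<^sub>n b) = 1 + ncost a + ncost b"
| "ncost (a -\<^sub>n b) = 1 + ncost a + ncost b"

fun rcost :: "rexp \<Rightarrow> nat" where
  "rcost (RC c) = 1"
| "rcost (RRead x es) = 1 + sum_list (map ncost es)"
| "rcost (a +\<^sub>r b) = 1 + rcost a + rcost b"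
| "rcost (a -\<^sub>r b) = 1 + rcost a + rcost b"

fun bcost :: "bexp \<Rightarrow> nat" where
  "bcost (a =\<^sub>n b) = 1 + ncost a + ncost b"
| "bcost (a <\<^sub>n b) = 1 + ncost a + ncost b"
| "bcost (c =\<^sub>r d) = 1 + rcost c + rcost d"
| "bcost (c <\<^sub>r d) = 1 + rcost c + rcost d"
| "bcost (Not p) = 1 + bcost p"
| "bcost (And p q) = 1 + bcost p + bcost q"
| "bcost (Or p q) = 1 + bcost p + bcost q"

definition nupdate :: "vname \<Rightarrow> nat list \<Rightarrow> nat \<Rightarrow> state \<Rightarrow> state" where
  "nupdate x is k s = s\<lparr>nval := (nval s)(x := (nval s x)(is := k))\<rparr>"

definition rupdate :: "vname \<Rightarrow> nat list \<Rightarrow> real \<Rightarrow> state \<Rightarrow> state" where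
  "rupdate x is r s = s\<lparr>rval := (rval s)(x := (rval s x)(is := r))\<rparr>"

type_synonym config = "com \<times> state"

text \<open>\<open>step cfg k cfg'\<close>: one machine step of cost \<open>k\<close>. Every step costs at least one unit.\<close>

inductive step :: "config \<Rightarrow> nat \<Rightarrow> config \<Rightarrow> bool" where
  NAssign: "step (NAssign x es e, s) (1 + sum_list (map ncost es) + ncost e)
              (SKIP, nupdate x (map (\<lambda>e. neval e s) es) (neval e s) s)"
| RAssign: "step (RAssign x es e, s) (1 + sum_list (map ncost es) + rcost e)
              (SKIP, rupdate x (map (\<lambda>e. neval e s) es) (reval e s) s)"
| Choose: "k < neval e s \<Longrightarrow> step (Choose x e, s) (1 + ncost e) (SKIP, nupdate x [] k s)"
| SeqSkip: "step (SKIP;; c, s) 1 (c, s)"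
| SeqStep: "step (c1, s) k (c1', s') \<Longrightarrow> step (c1;; c2, s) k (c1';; c2, s')"
| IfTrue: "beval p s \<Longrightarrow> step (IF p THEN c1 ELSE c2, s) (1 + bcost p) (c1, s)"
| IfFalse: "\<not> beval p s \<Longrightarrow> step (IF p THEN c1 ELSE c2, s) (1 + bcost p) (c2, s)"
| WhileTrue: "beval p s \<Longrightarrow> step (WHILE p DO c, s) (1 + bcost p) (c;; WHILE p DO c, s)"
| WhileFalse: "\<not> beval p s \<Longrightarrow> step (WHILE p DO c, s) (1 + bcost p) (SKIP, s)"

inductive steps :: "config \<Rightarrow> nat \<Rightarrow> config \<Rightarrow> bool" where
  refl: "steps cfg 0 cfg"
| step: "step cfg k cfg' \<Longrightarrow> steps cfg' k' cfg'' \<Longrightarrow> steps cfg (k + k') cfg''"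

definition final :: "config \<Rightarrow> bool" where
  "final cfg \<longleftrightarrow> \<not> (\<exists>k cfg'. step cfg k cfg')"

definition has_infinite_run :: "config \<Rightarrow> bool" where
  "has_infinite_run cfg \<longleftrightarrow> (\<exists>f. f 0 = cfg \<and> (\<forall>t::nat. \<exists>k. step (f t) k (f (Suc t))))"

text \<open>
  Concrete syntax. Natural number cells are indexed with \<open>\<langle> \<rangle>\<close>, real cells with \<open>\<lbrace> \<rbrace>\<close>; the scalar
  variables are read by \<open>V\<close> and \<open>R\<close>.
\<close>

abbreviation V :: "vname \<Rightarrow> nexp" where
  "V x \<equiv> NRead x []"
abbreviation NVec :: "vname \<Rightarrow> nexp \<Rightarrow> nexp"  (\<open>_\<langle>_\<rangle>\<close> [1000, 0] 1000) where
  "x\<langle>a\<rangle> \<equiv> NRead x [a]"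
abbreviation NMat :: "vname \<Rightarrow> nexp \<Rightarrow> nexp \<Rightarrow> nexp"  (\<open>_\<langle>_,_\<rangle>\<close> [1000, 0, 0] 1000) where
  "x\<langle>a, b\<rangle> \<equiv> NRead x [a, b]"
abbreviation R :: "vname \<Rightarrow> rexp" where
  "R x \<equiv> RRead x []"
abbreviation RVec :: "vname \<Rightarrow> nexp \<Rightarrow> rexp"  (\<open>_\<lbrace>_\<rbrace>\<close> [1000, 0] 1000) where
  "x\<lbrace>a\<rbrace> \<equiv> RRead x [a]"
abbreviation RMat :: "vname \<Rightarrow> nexp \<Rightarrow> nexp \<Rightarrow> rexp"  (\<open>_\<lbrace>_,_\<rbrace>\<close> [1000, 0, 0] 1000) where
  "x\<lbrace>a, b\<rbrace> \<equiv> RRead x [a, b]"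

abbreviation NAssignVar :: "vname \<Rightarrow> nexp \<Rightarrow> com"  (\<open>_ ::=\<^sub>n _\<close> [1000, 61] 61) where
  "x ::=\<^sub>n e \<equiv> NAssign x [] e"
abbreviation NAssignVec :: "vname \<Rightarrow> nexp \<Rightarrow> nexp \<Rightarrow> com"  (\<open>_\<langle>_\<rangle> ::= _\<close> [1000, 0, 61] 61) where
  "x\<langle>a\<rangle> ::= e \<equiv> NAssign x [a] e"
abbreviation NAssignMat :: "vname \<Rightarrow> nexp \<Rightarrow> nexp \<Rightarrow> nexp \<Rightarrow> com"
    (\<open>_\<langle>_,_\<rangle> ::= _\<close> [1000, 0, 0, 61] 61) where
  "x\<langle>a, b\<rangle> ::= e \<equiv> NAssign x [a, b] e"
abbreviation RAssignVar :: "vname \<Rightarrow> rexp \<Rightarrow> com"  (\<open>_ ::=\<^sub>r _\<close> [1000, 61] 61) where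
  "x ::=\<^sub>r e \<equiv> RAssign x [] e"
abbreviation RAssignVec :: "vname \<Rightarrow> nexp \<Rightarrow> rexp \<Rightarrow> com"  (\<open>_\<lbrace>_\<rbrace> ::= _\<close> [1000, 0, 61] 61) where
  "x\<lbrace>a\<rbrace> ::= e \<equiv> RAssign x [a] e"
abbreviation RAssignMat :: "vname \<Rightarrow> nexp \<Rightarrow> nexp \<Rightarrow> rexp \<Rightarrow> com"
    (\<open>_\<lbrace>_,_\<rbrace> ::= _\<close> [1000, 0, 0, 61] 61) where
  "x\<lbrace>a, b\<rbrace> ::= e \<equiv> RAssign x [a, b] e"

abbreviation IfThen :: "bexp \<Rightarrow> com \<Rightarrow> com"  (\<open>(WHEN _/ DO _)\<close> [0, 61] 61) where
  "WHEN p DO c \<equiv> IF p THEN c ELSE SKIP"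

definition For :: "vname \<Rightarrow> nexp \<Rightarrow> com \<Rightarrow> com"  (\<open>(FOR _/ TO _/ DO _)\<close> [0, 0, 61] 61) where
  "FOR x TO e DO c = (x ::=\<^sub>n N 0;; WHILE V x <\<^sub>n e DO (c;; x ::=\<^sub>n V x +\<^sub>n N 1))"


section \<open>The modified Hungarian algorithm with slack variables\<close>

text \<open>
  Input cells: the scalars \<open>m\<close> and \<open>n\<close>, the vector \<open>mu\<close>, the matrix \<open>C\<close>. The working cells include:

  \<^item> \<open>w\<close>: the weights; \<open>l1\<close> and \<open>l2\<close>: the labeling on \<open>V\<^sub>1\<close> and on \<open>V\<^sub>2\<close>;
  \<^item> \<open>M\<close>: the 0/1 matrix of the current pseudo-matching;
  \<^item> \<open>S\<close> and \<open>T\<close>: 0/1 indicator vectors of the sets \<open>S \<subseteq> V\<^sub>2\<close> and \<open>T \<subseteq> V\<^sub>1\<close>;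
  \<^item> \<open>slack\<close>: the slacks; the entries at nodes of \<open>T\<close> are discarded and never read;
  \<^item> \<open>deg1\<close> and \<open>deg2\<close>: the number of edges of \<open>M\<close> at each node;
  \<^item> \<open>from\<close> and \<open>via\<close>: the alternating tree. \<open>from\<langle>v\<^sub>1\<rangle>\<close> is the node of \<open>S\<close> from which \<open>v\<^sub>1\<close> was reached
    along an edge of \<open>E\<^sub>l\<close>, and \<open>via\<langle>z\<rangle>\<close> is the node of \<open>V\<^sub>1\<close> because of which \<open>z\<close> entered \<open>S\<close>.

  Whenever the algorithm picks something, the admissible candidates are first listed in the
  vector \<open>cand\<close>, of length \<open>cnt\<close>, and then an arbitrary one of them is taken, so that the runs
  of the program cover all possible ways of making the choices.
\<close>

definition compute_weights :: com where
  "compute_weights =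
     (''cmax'' ::=\<^sub>r ''C''\<lbrace>N 0, N 0\<rbrace>;;
      FOR ''i'' TO V ''m'' DO
        FOR ''j'' TO V ''n'' DO
          (WHEN R ''cmax'' <\<^sub>r ''C''\<lbrace>V ''i'', V ''j''\<rbrace> DO
            ''cmax'' ::=\<^sub>r ''C''\<lbrace>V ''i'', V ''j''\<rbrace>);;
      FOR ''i'' TO V ''m'' DO
        FOR ''j'' TO V ''n'' DO
          ''w''\<lbrace>V ''i'', V ''j''\<rbrace> ::= R ''cmax'' -\<^sub>r ''C''\<lbrace>V ''i'', V ''j''\<rbrace>)"

definition init_labels :: com where
  "init_labels =
     (FOR ''j'' TO V ''n'' DO
        ''l2''\<lbrace>V ''j''\<rbrace> ::= RC 0;;
      FOR ''i'' TO V ''m'' DO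
        (''l1''\<lbrace>V ''i''\<rbrace> ::= ''w''\<lbrace>V ''i'', N 0\<rbrace>;;
         FOR ''j'' TO V ''n'' DO
           (WHEN ''l1''\<lbrace>V ''i''\<rbrace> <\<^sub>r ''w''\<lbrace>V ''i'', V ''j''\<rbrace> DO
             ''l1''\<lbrace>V ''i''\<rbrace> ::= ''w''\<lbrace>V ''i'', V ''j''\<rbrace>)))"

text \<open>
  The initial pseudo-matching in \<open>E\<^sub>l\<close> is arbitrary: each row is either left unmatched
  (choice \<open>r = cnt\<close>) or matched along any tight edge to a column that still has capacity.
\<close>

definition init_matching :: com where
  "init_matching =
     (FOR ''j'' TO V ''n'' DO
        (''deg2''\<langle>V ''j''\<rangle> ::= N 0;;
         FOR ''i'' TO V ''m'' DO
           ''M''\<langle>V ''i'', V ''j''\<rangle> ::= N 0);;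
      FOR ''i'' TO V ''m'' DO
        (''cnt'' ::=\<^sub>n N 0;;
         FOR ''j'' TO V ''n'' DO
           (WHEN And (''deg2''\<langle>V ''j''\<rangle> <\<^sub>n ''mu''\<langle>V ''j''\<rangle>)
                     (''l1''\<lbrace>V ''i''\<rbrace> +\<^sub>r ''l2''\<lbrace>V ''j''\<rbrace> =\<^sub>r ''w''\<lbrace>V ''i'', V ''j''\<rbrace>) DO
             (''cand''\<langle>V ''cnt''\<rangle> ::= V ''j'';;
              ''cnt'' ::=\<^sub>n V ''cnt'' +\<^sub>n N 1));;
         Choose ''r'' (V ''cnt'' +\<^sub>n N 1);;
         WHEN V ''r'' <\<^sub>n V ''cnt'' DO
           (''z'' ::=\<^sub>n ''cand''\<langle>V ''r''\<rangle>;;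
            ''M''\<langle>V ''i'', V ''z''\<rangle> ::= N 1;;
            ''deg2''\<langle>V ''z''\<rangle> ::= ''deg2''\<langle>V ''z''\<rangle> +\<^sub>n N 1)))"

text \<open>
  The status of all nodes relative to \<open>M\<close>: computes the degrees, whether \<open>M\<close> is perfect, and the
  list of the free nodes of \<open>V\<^sub>2\<close>.
\<close>

definition compute_status :: com where
  "compute_status =
     (''perfect'' ::=\<^sub>n N 1;;
      FOR ''i'' TO V ''m'' DO
        (''deg1''\<langle>V ''i''\<rangle> ::= N 0;;
         FOR ''j'' TO V ''n'' DO
           ''deg1''\<langle>V ''i''\<rangle> ::= ''deg1''\<langle>V ''i''\<rangle> +\<^sub>n ''M''\<langle>V ''i'', V ''j''\<rangle>;;
         WHEN Not (''deg1''\<langle>V ''i''\<rangle> =\<^sub>n N 1) DO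
           ''perfect'' ::=\<^sub>n N 0);;
      ''cnt'' ::=\<^sub>n N 0;;
      FOR ''j'' TO V ''n'' DO
        (''deg2''\<langle>V ''j''\<rangle> ::= N 0;;
         FOR ''i'' TO V ''m'' DO
           ''deg2''\<langle>V ''j''\<rangle> ::= ''deg2''\<langle>V ''j''\<rangle> +\<^sub>n ''M''\<langle>V ''i'', V ''j''\<rangle>;;
         WHEN Not (''deg2''\<langle>V ''j''\<rangle> =\<^sub>n ''mu''\<langle>V ''j''\<rangle>) DO
           (''perfect'' ::=\<^sub>n N 0;;
            ''cand''\<langle>V ''cnt''\<rangle> ::= V ''j'';;
            ''cnt'' ::=\<^sub>n V ''cnt'' +\<^sub>n N 1)))"

definition add_matched_to_T :: "nexp \<Rightarrow> com" where
  "add_matched_to_T v =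
     (FOR ''i'' TO V ''m'' DO
        (WHEN ''M''\<langle>V ''i'', v\<rangle> =\<^sub>n N 1 DO
          ''T''\<langle>V ''i''\<rangle> ::= N 1))"

definition start_tree :: com where
  "start_tree =
     (Choose ''r'' (V ''cnt'');;
      ''vfree'' ::=\<^sub>n ''cand''\<langle>V ''r''\<rangle>;;
      FOR ''j'' TO V ''n'' DO
        ''S''\<langle>V ''j''\<rangle> ::= N 0;;
      FOR ''i'' TO V ''m'' DO
        ''T''\<langle>V ''i''\<rangle> ::= N 0;;
      ''S''\<langle>V ''vfree''\<rangle> ::= N 1;;
      add_matched_to_T (V ''vfree'');;
      FOR ''i'' TO V ''m'' DO
        (WHEN ''T''\<langle>V ''i''\<rangle> =\<^sub>n N 0 DO
          ''slack''\<lbrace>V ''i''\<rbrace> ::=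
            ''l1''\<lbrace>V ''i''\<rbrace> +\<^sub>r ''l2''\<lbrace>V ''vfree''\<rbrace> -\<^sub>r ''w''\<lbrace>V ''i'', V ''vfree''\<rbrace>))"

text \<open>Lists \<open>N\<^sub>l(S) - T\<close>, which consists of the nodes outside \<open>T\<close> with slack zero.\<close>

definition list_tight :: com where
  "list_tight =
     (''cnt'' ::=\<^sub>n N 0;;
      FOR ''i'' TO V ''m'' DO
        (WHEN And (''T''\<langle>V ''i''\<rangle> =\<^sub>n N 0) (''slack''\<lbrace>V ''i''\<rbrace> =\<^sub>r RC 0) DO
          (''cand''\<langle>V ''cnt''\<rangle> ::= V ''i'';;
           ''cnt'' ::=\<^sub>n V ''cnt'' +\<^sub>n N 1)))"

definition update_labels :: com where
  "update_labels =
     (''found'' ::=\<^sub>n N 0;;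
      FOR ''i'' TO V ''m'' DO
        (WHEN And (''T''\<langle>V ''i''\<rangle> =\<^sub>n N 0)
                  (Or (V ''found'' =\<^sub>n N 0) (''slack''\<lbrace>V ''i''\<rbrace> <\<^sub>r R ''alpha'')) DO
          (''alpha'' ::=\<^sub>r ''slack''\<lbrace>V ''i''\<rbrace>;;
           ''found'' ::=\<^sub>n N 1));;
      FOR ''j'' TO V ''n'' DO
        (WHEN ''S''\<langle>V ''j''\<rangle> =\<^sub>n N 1 DO
          ''l2''\<lbrace>V ''j''\<rbrace> ::= ''l2''\<lbrace>V ''j''\<rbrace> -\<^sub>r R ''alpha'');;
      FOR ''i'' TO V ''m'' DO
        (IF ''T''\<langle>V ''i''\<rangle> =\<^sub>n N 1
         THEN ''l1''\<lbrace>V ''i''\<rbrace> ::= ''l1''\<lbrace>V ''i''\<rbrace> +\<^sub>r R ''alpha''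
         ELSE ''slack''\<lbrace>V ''i''\<rbrace> ::= ''slack''\<lbrace>V ''i''\<rbrace> -\<^sub>r R ''alpha''))"

text \<open>
  Picks \<open>v\<^sub>1 \<in> N\<^sub>l(S) - T\<close> and a node of \<open>S\<close> joined to it by an edge of \<open>E\<^sub>l\<close>.
\<close>

definition pick_tight :: com where
  "pick_tight =
     (Choose ''r'' (V ''cnt'');;
      ''v1'' ::=\<^sub>n ''cand''\<langle>V ''r''\<rangle>;;
      ''cnt'' ::=\<^sub>n N 0;;
      FOR ''j'' TO V ''n'' DO
        (WHEN And (''S''\<langle>V ''j''\<rangle> =\<^sub>n N 1)
                  (''l1''\<lbrace>V ''v1''\<rbrace> +\<^sub>r ''l2''\<lbrace>V ''j''\<rbrace> =\<^sub>r ''w''\<lbrace>V ''v1'', V ''j''\<rbrace>) DO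
          (''cand''\<langle>V ''cnt''\<rangle> ::= V ''j'';;
           ''cnt'' ::=\<^sub>n V ''cnt'' +\<^sub>n N 1));;
      Choose ''r'' (V ''cnt'');;
      ''from''\<langle>V ''v1''\<rangle> ::= ''cand''\<langle>V ''r''\<rangle>)"

text \<open>
  Exchanges the status of all edges on the tree path between \<open>v\<^sub>1\<close> and \<open>v\<^sub>f\<^sub>r\<^sub>e\<^sub>e\<close>, walking from \<open>v\<^sub>1\<close>.
\<close>

definition augment :: com where
  "augment =
     (''u'' ::=\<^sub>n V ''v1'';;
      ''z'' ::=\<^sub>n ''from''\<langle>V ''u''\<rangle>;;
      ''M''\<langle>V ''u'', V ''z''\<rangle> ::= N 1 -\<^sub>n ''M''\<langle>V ''u'', V ''z''\<rangle>;;
      WHILE Not (V ''z'' =\<^sub>n V ''vfree'') DO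
        (''u'' ::=\<^sub>n ''via''\<langle>V ''z''\<rangle>;;
         ''M''\<langle>V ''u'', V ''z''\<rangle> ::= N 1 -\<^sub>n ''M''\<langle>V ''u'', V ''z''\<rangle>;;
         ''z'' ::=\<^sub>n ''from''\<langle>V ''u''\<rangle>;;
         ''M''\<langle>V ''u'', V ''z''\<rangle> ::= N 1 -\<^sub>n ''M''\<langle>V ''u'', V ''z''\<rangle>))"

definition extend_tree :: com where
  "extend_tree =
     (FOR ''j'' TO V ''n'' DO
        (WHEN ''M''\<langle>V ''v1'', V ''j''\<rangle> =\<^sub>n N 1 DO
          ''z'' ::=\<^sub>n V ''j'');;
      ''S''\<langle>V ''z''\<rangle> ::= N 1;;
      ''via''\<langle>V ''z''\<rangle> ::= V ''v1'';;
      ''T''\<langle>V ''v1''\<rangle> ::= N 1;;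
      add_matched_to_T (V ''z'');;
      FOR ''i'' TO V ''m'' DO
        (WHEN And (''T''\<langle>V ''i''\<rangle> =\<^sub>n N 0)
                  (''l1''\<lbrace>V ''i''\<rbrace> +\<^sub>r ''l2''\<lbrace>V ''z''\<rbrace> -\<^sub>r ''w''\<lbrace>V ''i'', V ''z''\<rbrace>
                     <\<^sub>r ''slack''\<lbrace>V ''i''\<rbrace>) DO
          ''slack''\<lbrace>V ''i''\<rbrace> ::=
            ''l1''\<lbrace>V ''i''\<rbrace> +\<^sub>r ''l2''\<lbrace>V ''z''\<rbrace> -\<^sub>r ''w''\<lbrace>V ''i'', V ''z''\<rbrace>))"

definition search_and_augment :: com where
  "search_and_augment =
     (start_tree;;
      ''augmented'' ::=\<^sub>n N 0;;
      WHILE V ''augmented'' =\<^sub>n N 0 DO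
        (list_tight;;
         WHEN V ''cnt'' =\<^sub>n N 0 DO
           (update_labels;; list_tight);;
         pick_tight;;
         IF ''deg1''\<langle>V ''v1''\<rangle> =\<^sub>n N 0
         THEN (augment;; ''augmented'' ::=\<^sub>n N 1)
         ELSE extend_tree))"

definition modified_hungarian :: com where
  "modified_hungarian =
     (compute_weights;;
      init_labels;;
      init_matching;;
      compute_status;;
      WHILE V ''perfect'' =\<^sub>n N 0 DO
        (search_and_augment;;
         compute_status))"

text \<open>The initial contents of all cells other than the input cells are arbitrary.\<close>

definition has_input ::
  "nat \<Rightarrow> nat \<Rightarrow> (nat \<Rightarrow> nat) \<Rightarrow> (nat \<Rightarrow> nat \<Rightarrow> real) \<Rightarrow> state \<Rightarrow> bool" where
  "has_input m n mu C s \<longleftrightarrow>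
     nval s ''m'' [] = m \<and> nval s ''n'' [] = n \<and>
     (\<forall>j<n. nval s ''mu'' [j] = mu j) \<and>
     (\<forall>i<m. \<forall>j<n. rval s ''C'' [i, j] = C i j)"

definition output_matching :: "nat \<Rightarrow> nat \<Rightarrow> state \<Rightarrow> (nat \<times> nat) set" where
  "output_matching m n s = {(i, j). i < m \<and> j < n \<and> nval s ''M'' [i, j] = 1}"

end

theory Submission
  imports Defs
begin

text \<open>
  The labels form a dual solution: if \<open>l(i) + l(j) \<ge> w(i, j)\<close> everywhere, with equality on a perfect
  pseudo-matching \<open>M\<close>, then \<open>\<Sum>\<^sub>i l(i) + \<Sum>\<^sub>j m\<^sub>j l(j)\<close> bounds the weight of every feasible matrix from
  above and is attained by \<open>M\<close>. Each search adds one edge to a pseudo-matching inside \<open>E\<^sub>l\<close>, so there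
  are at most \<open>m\<close> searches. During a search, \<open>T\<close> consists of the rows matched to \<open>S\<close>; hence the mate of a
  newly reached row is a new column, \<open>S\<close> grows at most \<open>n\<close> times, and a free row always stays outside \<open>T\<close>,
  so that a label update produces a new tight edge. Thanks to the slacks each growth step costs
  \<open>O(m + n)\<close>, which is \<open>O(m)\<close>, and the total is \<open>O(m\<^sup>2 n)\<close>.
\<close>

section \<open>Total correctness with a cost budget\<close>

text \<open>Since picks are arbitrary and \<open>Choose\<close> gets stuck on an empty range,
  correctness needs more than invariants: each pick needs a nonempty candidate list. A free column
  exists because edges are counted both by rows and by columns, and both counts equal
  \<open>m\<close> once all columns are full. A tight row exists after a label update because the
  row with minimal slack becomes tight. A column of \<open>S\<close> tight with the picked row
  exists because a slack is an attained minimum. The choice left to the initial matching always has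
  at least one option, that of taking no edge.

  Matchings are matrices over \<open>nat\<close>, so degrees are plain sums and flipping an edge
  changes one summand. In the middle of an augmentation the matrix is not a matching, since one
  column has an edge too many; this intermediate state has its own invariant.

  All degrees are recomputed after every search. This costs O(mn), no more than the bound for the
  search itself. Constants are rounded up generously, and \<open>1 \<le> n \<le> m\<close> absorbs
  all lower-order terms.\<close>

text \<open>
  The choices of the program are resolved adversarially: \<open>ensures Q c s B\<close> speaks about all runs.
  Since every step costs at least one unit, the budget also excludes infinite runs.
\<close>

inductive ensures :: "(state \<Rightarrow> bool) \<Rightarrow> com \<Rightarrow> state \<Rightarrow> nat \<Rightarrow> bool" for Q where
  ensures_SKIP: "Q s \<Longrightarrow> ensures Q SKIP s B"
| ensures_step: "c \<noteq> SKIP \<Longrightarrow> \<exists>k cfg. step (c, s) k cfg \<Longrightarrow>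
    (\<And>k c' s'. step (c, s) k (c', s') \<Longrightarrow> k \<le> B) \<Longrightarrow>
    (\<And>k c' s'. step (c, s) k (c', s') \<Longrightarrow> ensures Q c' s' (B - k)) \<Longrightarrow> ensures Q c s B"

inductive_cases step_SKIP: "step (SKIP, s) k cfg"
inductive_cases step_NAssign: "step (NAssign x es e, s) k cfg"
inductive_cases step_RAssign: "step (RAssign x es e, s) k cfg"
inductive_cases step_Choose: "step (Choose x e, s) k cfg"
inductive_cases step_Seq: "step (c1;; c2, s) k cfg"
inductive_cases step_If: "step (IF p THEN c1 ELSE c2, s) k cfg"
inductive_cases step_While: "step (WHILE p DO c, s) k cfg"

section \<open>Soundness of the budget with respect to machine runs\<close>

text \<open>The induction follows the derivation of \<open>ensures\<close>, not the run. The
  remaining budget \<open>B - k\<close> is a truncated difference, but \<open>k \<le> B\<close> is a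
  premise of the rule, so the costs add up correctly. The bound holds for every prefix of a run;
  finality is then possible only in \<open>SKIP\<close>, because any other command covered by
  \<open>ensures\<close> can make a step.\<close>

lemma ensures_steps:
  assumes "ensures Q c s B" "steps (c, s) k (c', s')"
  shows "k \<le> B \<and> (final (c', s') \<longrightarrow> c' = SKIP \<and> Q s')"
  using assms
proof (induction arbitrary: k rule: ensures.induct)
  case (ensures_SKIP s B)
  from ensures_SKIP(2) show ?case
    by (cases rule: steps.cases) (use ensures_SKIP(1) step_SKIP in auto)
next
  case (ensures_step c s B)
  from ensures_step(6) show ?case
  proof (cases rule: steps.cases)
    case refl
    then show ?thesis using ensures_step(2) by (auto simp: final_def)
  next
    case (step k1 cfg k2)
    obtain c1 s1 where cfg: "cfg = (c1, s1)" by force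
    with step ensures_step(3,5) show ?thesis by fastforce
  qed
qed

text \<open>Termination is the well-foundedness of the inductive definition: the tail of an infinite
  run is an infinite run from a configuration covered by the induction hypothesis.\<close>

lemma ensures_no_infinite_run:
  assumes "ensures Q c s B"
  shows "\<not> has_infinite_run (c, s)"
  using assms
proof (induction rule: ensures.induct)
  case (ensures_SKIP s B)
  show ?case
    unfolding has_infinite_run_def using step_SKIP by metis
next
  case (ensures_step c s B)
  show ?case
  proof
    assume "has_infinite_run (c, s)"
    then obtain f where f: "f 0 = (c, s)" "\<And>t::nat. \<exists>k. step (f t) k (f (Suc t))"
      by (auto simp: has_infinite_run_def)
    obtain c1 s1 where 1: "f 1 = (c1, s1)" by force
    with f(1) f(2)[of 0] obtain k where "step (c, s) k (c1, s1)" by auto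
    moreover have "has_infinite_run (c1, s1)"
      unfolding has_infinite_run_def using 1 f(2) by (intro exI[of _ "\<lambda>t. f (Suc t)"]) auto
    ultimately show False using ensures_step(5) by blast
  qed
qed

section \<open>Proof rules for the commands\<close>

lemma ensures_mono:
  assumes "ensures Q c s B" "\<And>t. Q t \<Longrightarrow> Q' t" "B \<le> B'"
  shows "ensures Q' c s B'"
  using assms
proof (induction arbitrary: B' rule: ensures.induct)
  case (ensures_SKIP s B)
  then show ?case by (blast intro: ensures.ensures_SKIP)
next
  case (ensures_step c s B)
  show ?case
  proof (rule ensures.ensures_step)
    show "c \<noteq> SKIP" "\<exists>k cfg. step (c, s) k cfg" by fact+
  next
    fix k c' s' assume st: "step (c, s) k (c', s')"
    then show "k \<le> B'" using ensures_step(3,7) le_trans by blast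
    show "ensures Q' c' s' (B' - k)"
      using ensures_step(5)[OF st ensures_step(6)] ensures_step(7) diff_le_mono by blast
  qed
qed

text \<open>The additional unit pays for the machine step that discards the \<open>SKIP\<close> left
  over from \<open>c1\<close>.\<close>

lemma ensures_Seq:
  assumes "ensures P c1 s B1" "\<And>t. P t \<Longrightarrow> ensures Q c2 t B2"
  shows "ensures Q (c1;; c2) s (B1 + B2 + 1)"
  using assms
proof (induction rule: ensures.induct)
  case (ensures_SKIP s B)
  show ?case
  proof (rule ensures.ensures_step)
    show "\<exists>k cfg. step (SKIP;; c2, s) k cfg" using step.SeqSkip by blast
  next
    fix k c' s' assume "step (SKIP;; c2, s) k (c', s')"
    then have *: "k = 1" "c' = c2" "s' = s"
      by (auto elim!: step_Seq step_SKIP)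
    then show "k \<le> B + B2 + 1" by simp
    show "ensures Q c' s' (B + B2 + 1 - k)"
      using * ensures_SKIP ensures_mono[of Q c2 s B2 Q "B + B2"] by simp
  qed simp
next
  case (ensures_step c s B)
  show ?case
  proof (rule ensures.ensures_step)
    show "\<exists>k cfg. step (c;; c2, s) k cfg" using ensures_step(2) step.SeqStep by fast
  next
    fix k c' s' assume "step (c;; c2, s) k (c', s')"
    then obtain c1' where *: "step (c, s) k (c1', s')" "c' = c1';; c2"
      using ensures_step(1) by (auto elim: step_Seq)
    have "k \<le> B" using ensures_step(3) * by blast
    then show "k \<le> B + B2 + 1" by simp
    have "ensures Q (c1';; c2) s' (B - k + B2 + 1)" using ensures_step(5)[OF *(1)] ensures_step(6) by blast
    moreover have "B - k + B2 + 1 = B + B2 + 1 - k" using \<open>k \<le> B\<close> by simp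
    ultimately show "ensures Q c' s' (B + B2 + 1 - k)" using *(2) by metis
  qed simp
qed

text \<open>\<open>;;\<close> associates to the left, whereas proofs consume a program from its
  first command on. The two bracketings run in lockstep with equal step costs, so the budget is
  unchanged.\<close>

lemma ensures_Seq_assoc:
  assumes "ensures Q (c1;; (c2;; c3)) s B"
  shows "ensures Q (c1;; c2;; c3) s B"
  using assms
proof (induction "c1;; (c2;; c3)" s B arbitrary: c1 rule: ensures.induct)
  case (ensures_step s B)
  show ?case
  proof (rule ensures.ensures_step)
    show "\<exists>k cfg. step (c1;; c2;; c3, s) k cfg"
      using ensures_step(2) by (elim exE step_Seq) (use step.SeqSkip step.SeqStep in blast)+
  next
    fix k c' s' assume "step (c1;; c2;; c3, s) k (c', s')"
    then consider "c1 = SKIP" "k = 1" "c' = c2;; c3" "s' = s"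
      | c1' where "step (c1, s) k (c1', s')" "c' = c1';; c2;; c3"
      by (auto elim!: step_Seq step_SKIP)
    then have "k \<le> B \<and> ensures Q c' s' (B - k)"
    proof cases
      case 1
      then show ?thesis using ensures_step(3,4) step.SeqSkip by blast
    next
      case 2
      then show ?thesis using ensures_step(3,5) step.SeqStep by blast
    qed
    then show "k \<le> B" "ensures Q c' s' (B - k)" by simp_all
  qed simp
qed

lemma ensures_NAssign:
  assumes "Q (nupdate x (map (\<lambda>e. neval e s) es) (neval e s) s)"
  shows "ensures Q (NAssign x es e) s (1 + sum_list (map ncost es) + ncost e)"
  by (rule ensures.ensures_step)
    (use assms in \<open>auto elim!: step_NAssign intro: ensures_SKIP step.NAssign\<close>)

lemma ensures_RAssign:
  assumes "Q (rupdate x (map (\<lambda>e. neval e s) es) (reval e s) s)"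
  shows "ensures Q (RAssign x es e) s (1 + sum_list (map ncost es) + rcost e)"
  by (rule ensures.ensures_step)
    (use assms in \<open>auto elim!: step_RAssign intro: ensures_SKIP step.RAssign\<close>)

lemma ensures_Choose:
  assumes "0 < neval e s" "\<And>k. k < neval e s \<Longrightarrow> Q (nupdate x [] k s)"
  shows "ensures Q (Choose x e) s (1 + ncost e)"
  by (rule ensures.ensures_step)
    (use assms in \<open>auto elim!: step_Choose intro: ensures_SKIP step.Choose\<close>)

lemma ensures_If:
  assumes "beval p s \<Longrightarrow> ensures Q c1 s B" "\<not> beval p s \<Longrightarrow> ensures Q c2 s B"
  shows "ensures Q (IF p THEN c1 ELSE c2) s (1 + bcost p + B)"
proof (rule ensures.ensures_step)
  show "\<exists>k cfg. step (IF p THEN c1 ELSE c2, s) k cfg"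
    using step.IfTrue step.IfFalse by (cases "beval p s") blast+
qed (use assms in \<open>auto elim!: step_If\<close>)

lemma ensures_While_unfold:
  assumes "beval p s \<Longrightarrow> ensures Q (c;; WHILE p DO c) s B" "\<not> beval p s \<Longrightarrow> Q s"
  shows "ensures Q (WHILE p DO c) s (1 + bcost p + B)"
proof (rule ensures.ensures_step)
  show "\<exists>k cfg. step (WHILE p DO c, s) k cfg"
    using step.WhileTrue step.WhileFalse by (cases "beval p s") blast+
qed (use assms in \<open>auto elim!: step_While intro: ensures_SKIP\<close>)

text \<open>Derivations are well-founded and every configuration other than \<open>SKIP\<close> in
  them has a successor, so some run ends. This closes the case of a loop body that would have to
  decrease a variant already equal to 0.\<close>

lemma ensures_not_False: "\<not> ensures (\<lambda>_. False) c s B"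
proof
  assume "ensures (\<lambda>_. False) c s B"
  then show False by (induction rule: ensures.induct) auto
qed

text \<open>A round costs \<open>B\<close> for the body, \<open>bcost p\<close> for the guard, one
  unit for unfolding the loop and one for the sequencing step. The trailing
  \<open>bcost p + 1\<close> is the guard test that fails.\<close>

lemma ensures_While:
  assumes "I s"
    and "\<And>t. I t \<Longrightarrow> beval p t \<Longrightarrow> ensures (\<lambda>t'. I t' \<and> v t' < v t) c t B"
    and "\<And>t. I t \<Longrightarrow> \<not> beval p t \<Longrightarrow> Q t"
    and "v s \<le> k"
  shows "ensures Q (WHILE p DO c) s (k * (B + bcost p + 2) + bcost p + 1)"
  using assms(1,4)
proof (induction k arbitrary: s)
  case 0
  have "ensures Q (WHILE p DO c) s (1 + bcost p + 0)"
  proof (rule ensures_While_unfold)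
    assume "beval p s"
    with 0 assms(2) have e: "ensures (\<lambda>t'. I t' \<and> v t' < v s) c s B" by blast
    have "ensures (\<lambda>_. False) c s B" by (rule ensures_mono[OF e]) (use 0 in auto)
    then show "ensures Q (c;; WHILE p DO c) s 0" using ensures_not_False by blast
  qed (use 0 assms(3) in blast)
  then show ?case by simp
next
  case (Suc k)
  have "ensures Q (WHILE p DO c) s (1 + bcost p + (B + (k * (B + bcost p + 2) + bcost p + 1) + 1))"
  proof (rule ensures_While_unfold)
    assume "beval p s"
    with Suc.prems assms(2) have "ensures (\<lambda>t'. I t' \<and> v t' < v s) c s B" by blast
    then show "ensures Q (c;; WHILE p DO c) s (B + (k * (B + bcost p + 2) + bcost p + 1) + 1)"
      by (rule ensures_Seq) (use Suc in auto)
  qed (use Suc.prems assms(3) in blast)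
  then show ?case by (simp add: algebra_simps)
qed

text \<open>
  These two functions are only meant for loop-free commands: \<open>wp\<close> is false and \<open>cost_bound\<close> is a
  dummy value on loops.
\<close>

fun wp :: "com \<Rightarrow> (state \<Rightarrow> bool) \<Rightarrow> state \<Rightarrow> bool" where
  "wp SKIP Q s \<longleftrightarrow> Q s"
| "wp (NAssign x es e) Q s \<longleftrightarrow> Q (nupdate x (map (\<lambda>e. neval e s) es) (neval e s) s)"
| "wp (RAssign x es e) Q s \<longleftrightarrow> Q (rupdate x (map (\<lambda>e. neval e s) es) (reval e s) s)"
| "wp (Choose x e) Q s \<longleftrightarrow> 0 < neval e s \<and> (\<forall>k < neval e s. Q (nupdate x [] k s))"
| "wp (c1;; c2) Q s \<longleftrightarrow> wp c1 (wp c2 Q) s"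
| "wp (IF p THEN c1 ELSE c2) Q s \<longleftrightarrow> (if beval p s then wp c1 Q s else wp c2 Q s)"
| "wp (WHILE p DO c) Q s \<longleftrightarrow> False"

fun cost_bound :: "com \<Rightarrow> nat" where
  "cost_bound SKIP = 0"
| "cost_bound (NAssign x es e) = 1 + sum_list (map ncost es) + ncost e"
| "cost_bound (RAssign x es e) = 1 + sum_list (map ncost es) + rcost e"
| "cost_bound (Choose x e) = 1 + ncost e"
| "cost_bound (c1;; c2) = cost_bound c1 + cost_bound c2 + 1"
| "cost_bound (IF p THEN c1 ELSE c2) = 1 + bcost p + (cost_bound c1 + cost_bound c2)"
| "cost_bound (WHILE p DO c) = 0"

lemma ensures_wp:
  assumes "wp c Q s"
  shows "ensures Q c s (cost_bound c)"
  using assms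
proof (induction c arbitrary: Q s)
  case (Seq c1 c2)
  show ?case unfolding cost_bound.simps by (rule ensures_Seq[where P = "wp c2 Q"]) (use Seq in auto)
next
  case (If p c1 c2)
  show ?case unfolding cost_bound.simps
  proof (rule ensures_If)
    assume "beval p s"
    with If show "ensures Q c1 s (cost_bound c1 + cost_bound c2)"
      by (intro ensures_mono[OF If.IH(1)]) auto
  next
    assume "\<not> beval p s"
    with If show "ensures Q c2 s (cost_bound c1 + cost_bound c2)"
      by (intro ensures_mono[OF If.IH(2)]) auto
  qed
qed (use ensures_SKIP ensures_NAssign ensures_RAssign ensures_Choose in auto)

lemma ensures_wp_le:
  assumes "wp c Q s" "cost_bound c \<le> B"
  shows "ensures Q c s B"
  using ensures_mono[OF ensures_wp] assms by blast

section \<open>Frames: the cells that a command leaves alone\<close>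

fun nmods :: "com \<Rightarrow> vname set" where
  "nmods SKIP = {}"
| "nmods (NAssign x es e) = {x}"
| "nmods (RAssign x es e) = {}"
| "nmods (Choose x e) = {x}"
| "nmods (c1;; c2) = nmods c1 \<union> nmods c2"
| "nmods (IF p THEN c1 ELSE c2) = nmods c1 \<union> nmods c2"
| "nmods (WHILE p DO c) = nmods c"

fun rmods :: "com \<Rightarrow> vname set" where
  "rmods SKIP = {}"
| "rmods (NAssign x es e) = {}"
| "rmods (RAssign x es e) = {x}"
| "rmods (Choose x e) = {}"
| "rmods (c1;; c2) = rmods c1 \<union> rmods c2"
| "rmods (IF p THEN c1 ELSE c2) = rmods c1 \<union> rmods c2"
| "rmods (WHILE p DO c) = rmods c"

lemma nmods_For [simp]: "nmods (FOR x TO e DO c) = insert x (nmods c)"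
  and rmods_For [simp]: "rmods (FOR x TO e DO c) = rmods c"
  by (auto simp: For_def)

lemma nval_nupdate [simp]:
    "nval (nupdate x is k s) y = (if y = x then (nval s x)(is := k) else nval s y)"
  and rval_nupdate [simp]: "rval (nupdate x is k s) = rval s"
  and nval_rupdate [simp]: "nval (rupdate x is r s) = nval s"
  and rval_rupdate [simp]:
    "rval (rupdate x is r s) y = (if y = x then (rval s x)(is := r) else rval s y)"
  by (auto simp: nupdate_def rupdate_def)

text \<open>Frames go by cell name, so an array counts as modified as a whole. What a loop does to
  the other entries of the array it writes must therefore be part of its invariant.\<close>

definition frame :: "vname set \<Rightarrow> vname set \<Rightarrow> state \<Rightarrow> state \<Rightarrow> bool" where
  "frame A B s t \<longleftrightarrow> (\<forall>x. x \<notin> A \<longrightarrow> nval t x = nval s x) \<and> (\<forall>x. x \<notin> B \<longrightarrow> rval t x = rval s x)"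

lemma frame_nval: "frame A B s t \<Longrightarrow> x \<notin> A \<Longrightarrow> nval t x = nval s x"
  and frame_rval: "frame A B s t \<Longrightarrow> x \<notin> B \<Longrightarrow> rval t x = rval s x"
  by (auto simp: frame_def)

lemma frame_refl: "frame A B s s"
  by (simp add: frame_def)

lemma frame_trans: "frame A B s t \<Longrightarrow> frame A B t u \<Longrightarrow> frame A B s u"
  by (simp add: frame_def)

lemma frame_mono: "frame A B s t \<Longrightarrow> A \<subseteq> A' \<Longrightarrow> B \<subseteq> B' \<Longrightarrow> frame A' B' s t"
  by (auto simp: frame_def)

lemma step_frame:
  assumes "step cfg k cfg'"
  shows "nmods (fst cfg') \<subseteq> nmods (fst cfg) \<and> rmods (fst cfg') \<subseteq> rmods (fst cfg) \<and>
    frame (nmods (fst cfg)) (rmods (fst cfg)) (snd cfg) (snd cfg')"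
  using assms by (induction rule: step.induct) (auto simp: frame_def)

text \<open>Allows the specifications below to mention only what changes. It holds because a single
  step touches only named cells, and the residual command names no further ones.\<close>

lemma ensures_frame:
  assumes "ensures Q c s B"
  shows "ensures (\<lambda>t. Q t \<and> frame (nmods c) (rmods c) s t) c s B"
  using assms
proof (induction rule: ensures.induct)
  case (ensures_SKIP s B)
  then show ?case by (auto intro: ensures.ensures_SKIP frame_refl)
next
  case (ensures_step c s B)
  show ?case
  proof (rule ensures.ensures_step)
    fix k c' s' assume st: "step (c, s) k (c', s')"
    then show "k \<le> B" by fact
    show "ensures (\<lambda>t. Q t \<and> frame (nmods c) (rmods c) s t) c' s' (B - k)"
      using ensures_step(5)[OF st] step_frame[OF st]
      by (elim ensures_mono) (auto intro: frame_trans frame_mono)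
  qed (use ensures_step in auto)
qed

lemma ensures_frame_mono:
  assumes "ensures Q c s B" "\<And>t. Q t \<Longrightarrow> frame (nmods c) (rmods c) s t \<Longrightarrow> Q' t" "B \<le> B'"
  shows "ensures Q' c s B'"
  by (rule ensures_mono[OF ensures_frame[OF assms(1)]]) (use assms in auto)

lemma ensures_Seq_frame:
  assumes "ensures P c1 s B1" "B1 + B2 + 1 \<le> B"
    and "\<And>t. P t \<Longrightarrow> frame (nmods c1) (rmods c1) s t \<Longrightarrow> ensures Q c2 t B2"
  shows "ensures Q (c1;; c2) s B"
  by (rule ensures_mono[OF ensures_Seq[OF ensures_frame[OF assms(1)]]]) (use assms in auto)

lemma ensures_Seq_wp:
  assumes "wp c1 (\<lambda>t. ensures Q c2 t B2) s" "cost_bound c1 + B2 + 1 \<le> B"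
  shows "ensures Q (c1;; c2) s B"
  by (rule ensures_mono[OF ensures_Seq[OF ensures_wp[OF assms(1)]]]) (use assms in auto)

lemma ensures_If_le:
  assumes "beval p s \<Longrightarrow> ensures Q c1 s B" "\<not> beval p s \<Longrightarrow> ensures Q c2 s B" "1 + bcost p + B \<le> B'"
  shows "ensures Q (IF p THEN c1 ELSE c2) s B'"
  by (rule ensures_mono[OF ensures_If _ assms(3)]) (use assms(1,2) in auto)

lemma ensures_While_frame:
  assumes "I s"
    and "\<And>t. I t \<Longrightarrow> frame (nmods c) (rmods c) s t \<Longrightarrow> beval p t \<Longrightarrow>
      ensures (\<lambda>t'. I t' \<and> v t' < v t) c t B"
    and "\<And>t. I t \<Longrightarrow> frame (nmods c) (rmods c) s t \<Longrightarrow> \<not> beval p t \<Longrightarrow> Q t"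
    and "v s \<le> k"
  shows "ensures Q (WHILE p DO c) s (k * (B + bcost p + 2) + bcost p + 1)"
proof (rule ensures_While[where I = "\<lambda>t. I t \<and> frame (nmods c) (rmods c) s t" and v = v])
  fix t assume t: "I t \<and> frame (nmods c) (rmods c) s t" "beval p t"
  then have "ensures (\<lambda>t'. I t' \<and> v t' < v t) c t B" using assms(2) by blast
  then show "ensures (\<lambda>t'. (I t' \<and> frame (nmods c) (rmods c) s t') \<and> v t' < v t) c t B"
    by (rule ensures_frame_mono) (use t frame_trans in blast)+
qed (use assms frame_refl in auto)

text \<open>The invariant takes the loop index as an argument, and the body has to establish it in
  the state in which the counter is already incremented. The 10 units per round are 4 for the
  increment, 3 for the guard and 3 for unfolding and sequencing; the final 7 are 2 for the initial
  assignment, 1 for sequencing and 4 for the failing guard test.\<close>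

lemma ensures_For:
  assumes x: "x \<notin> nmods c" and y: "y \<notin> nmods c" "y \<noteq> x" "nval s y [] = k"
    and init: "I 0 (nupdate x [] 0 s)"
    and body: "\<And>i t. i < k \<Longrightarrow> I i t \<Longrightarrow> nval t x [] = i \<Longrightarrow> frame (insert x (nmods c)) (rmods c) s t \<Longrightarrow>
      ensures (\<lambda>t'. frame (nmods c) (rmods c) t t' \<longrightarrow> I (Suc i) (nupdate x [] (Suc i) t')) c t B"
    and post: "\<And>t. I k t \<Longrightarrow> frame (insert x (nmods c)) (rmods c) s t \<Longrightarrow> Q t"
  shows "ensures Q (FOR x TO V y DO c) s (k * (B + 10) + 7)"
proof -
  let ?F = "frame (insert x (nmods c)) (rmods c)"
  let ?c = "c;; x ::=\<^sub>n V x +\<^sub>n N 1"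
  let ?J = "\<lambda>t. nval t x [] \<le> k \<and> I (nval t x []) t \<and> ?F s t"
  have loop: "ensures Q (WHILE V x <\<^sub>n V y DO ?c) t (k * ((B + 4 + 1) + bcost (V x <\<^sub>n V y) + 2) + bcost (V x <\<^sub>n V y) + 1)"
    if "?J t" for t
  proof (rule ensures_While[where I = ?J and v = "\<lambda>t. k - nval t x []"])
    show "?J t" by fact
  next
    fix t assume J: "?J t" and "beval (V x <\<^sub>n V y) t"
    moreover have yk: "nval t y [] = k" using J y frame_nval[of _ _ s t y] by auto
    ultimately have lt: "nval t x [] < k" by simp
    let ?i = "nval t x []"
    have b: "ensures (\<lambda>t'. frame (nmods c) (rmods c) t t' \<longrightarrow> I (Suc ?i) (nupdate x [] (Suc ?i) t')) c t B"
      using body[OF lt] J by blast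
    show "ensures (\<lambda>t'. ?J t' \<and> k - nval t' x [] < k - ?i) ?c t (B + 4 + 1)"
    proof (rule ensures_Seq)
      show "ensures (\<lambda>t'. I (Suc ?i) (nupdate x [] (Suc ?i) t') \<and> frame (nmods c) (rmods c) t t') c t B"
        by (rule ensures_frame_mono[OF b]) auto
    next
      fix u assume u: "I (Suc ?i) (nupdate x [] (Suc ?i) u) \<and> frame (nmods c) (rmods c) t u"
      then have ux: "nval u x [] = ?i" using frame_nval x by metis
      have "?F s (nupdate x [] (Suc ?i) u)" using J u by (auto simp: frame_def)
      then show "ensures (\<lambda>t'. ?J t' \<and> k - nval t' x [] < k - ?i) (x ::=\<^sub>n V x +\<^sub>n N 1) u 4"
        by (intro ensures_wp_le) (use u ux lt in auto)
    qed
  next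
    fix t assume J: "?J t" and "\<not> beval (V x <\<^sub>n V y) t"
    moreover have yk: "nval t y [] = k" using J y frame_nval[of _ _ s t y] by auto
    ultimately have "nval t x [] = k" by simp
    with J show "Q t" using post[of t] by simp
  qed simp
  have "?F s (nupdate x [] 0 s)" by (auto simp: frame_def)
  then have "ensures ?J (x ::=\<^sub>n N 0) s 2" by (intro ensures_wp_le) (use init in auto)
  then have "ensures Q (x ::=\<^sub>n N 0;; WHILE V x <\<^sub>n V y DO ?c) s
    (2 + (k * ((B + 4 + 1) + bcost (V x <\<^sub>n V y) + 2) + bcost (V x <\<^sub>n V y) + 1) + 1)"
    by (rule ensures_Seq) (rule loop)
  then show ?thesis unfolding For_def by (elim ensures_mono) (auto simp: algebra_simps)
qed

lemma ensures_For_le: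
  assumes "x \<notin> nmods c" "y \<notin> nmods c" "y \<noteq> x" "nval s y [] = k"
    and "I 0 (nupdate x [] 0 s)"
    and "\<And>i t. i < k \<Longrightarrow> I i t \<Longrightarrow> nval t x [] = i \<Longrightarrow> frame (insert x (nmods c)) (rmods c) s t \<Longrightarrow>
      ensures (\<lambda>t'. frame (nmods c) (rmods c) t t' \<longrightarrow> I (Suc i) (nupdate x [] (Suc i) t')) c t B"
    and "\<And>t. I k t \<Longrightarrow> frame (insert x (nmods c)) (rmods c) s t \<Longrightarrow> Q t"
    and "k * (B + 10) + 7 \<le> B'"
  shows "ensures Q (FOR x TO V y DO c) s B'"
  by (rule ensures_mono[OF ensures_For[where I = I, OF assms(1-7)] _ assms(8)])

text \<open>Balanced by a summand on each side, since subtraction on \<open>nat\<close> truncates.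
  \<open>row_set\<close> and \<open>col_set\<close> have the same form for this reason.\<close>

lemma sum_fun_upd:
  fixes f :: "'a \<Rightarrow> nat"
  assumes "finite A" "u \<in> A"
  shows "(\<Sum>i\<in>A. if i = u then c else f i) + f u = sum f A + c"
proof -
  have "(\<Sum>i\<in>A - {u}. if i = u then c else f i) = sum f (A - {u})" by (intro sum.cong) auto
  then show ?thesis
    using sum.remove[OF assms, of "\<lambda>i. if i = u then c else f i"] sum.remove[OF assms, of f] by simp
qed

lemma member_le_sum_nat:
  fixes f :: "'a \<Rightarrow> nat"
  assumes "finite A" "i \<in> A"
  shows "f i \<le> sum f A"
  using sum.remove[OF assms, of f] by simp

lemma two_members_le_sum_nat:
  fixes f :: "'a \<Rightarrow> nat"
  assumes "finite A" "i \<in> A" "j \<in> A" "i \<noteq> j"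
  shows "f i + f j \<le> sum f A"
proof -
  have "f j \<le> sum f (A - {i})" using assms by (intro member_le_sum_nat) auto
  then show ?thesis using sum.remove[OF assms(1,2), of f] by simp
qed

section \<open>Tight pseudo-matchings and alternating trees\<close>

text \<open>The weights are an arbitrary matrix; within the locale only
  \<open>perfect_optimal\<close> ties them to the costs.\<close>

locale matching_problem =
  fixes m n :: nat and mu :: "nat \<Rightarrow> nat" and w :: "nat \<Rightarrow> nat \<Rightarrow> real"
  assumes n_pos: "0 < n" and n_le_m: "n \<le> m" and sum_mu: "(\<Sum>j<n. mu j) = m"
begin

definition row :: "(nat \<Rightarrow> nat \<Rightarrow> nat) \<Rightarrow> nat \<Rightarrow> nat" where
  "row a i = (\<Sum>j<n. a i j)"

definition col :: "(nat \<Rightarrow> nat \<Rightarrow> nat) \<Rightarrow> nat \<Rightarrow> nat" where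
  "col a j = (\<Sum>i<m. a i j)"

definition total :: "(nat \<Rightarrow> nat \<Rightarrow> nat) \<Rightarrow> nat" where
  "total a = (\<Sum>i<m. row a i)"

definition perfect :: "(nat \<Rightarrow> nat \<Rightarrow> nat) \<Rightarrow> bool" where
  "perfect a \<longleftrightarrow> (\<forall>i<m. row a i = 1) \<and> (\<forall>j<n. col a j = mu j)"

text \<open>That the entries inside the ranges are 0 or 1 is not stated, as it follows from the row
  sums being at most 1 (\<open>tight_matching_entry\<close>).\<close>

definition tight_matching :: "(nat \<Rightarrow> nat \<Rightarrow> nat) \<Rightarrow> (nat \<Rightarrow> real) \<Rightarrow> (nat \<Rightarrow> real) \<Rightarrow> bool" where
  "tight_matching a l1 l2 \<longleftrightarrow> (\<forall>i<m. row a i \<le> 1) \<and> (\<forall>j<n. col a j \<le> mu j) \<and>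
     (\<forall>i<m. \<forall>j<n. w i j \<le> l1 i + l2 j) \<and>
     (\<forall>i<m. \<forall>j<n. a i j = 1 \<longrightarrow> l1 i + l2 j = w i j)"

text \<open>
  The rank \<open>r\<close> decreases along the path from a column of \<open>S\<close> to the root \<open>vf\<close>. It is bounded by
  the size of \<open>S\<close>, so it also bounds the length of an augmenting path.
\<close>

definition tree ::
  "(nat \<Rightarrow> nat \<Rightarrow> nat) \<Rightarrow> (nat \<Rightarrow> real) \<Rightarrow> (nat \<Rightarrow> real) \<Rightarrow> nat \<Rightarrow> (nat \<Rightarrow> nat) \<Rightarrow> (nat \<Rightarrow> nat) \<Rightarrow>
    (nat \<Rightarrow> nat) \<Rightarrow> (nat \<Rightarrow> nat) \<Rightarrow> (nat \<Rightarrow> nat) \<Rightarrow> bool" where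
  "tree a l1 l2 vf S fr vi r T \<longleftrightarrow> vf < n \<and> S vf = 1 \<and> col a vf < mu vf \<and>
     (\<forall>i<m. T i = (if \<exists>j<n. S j = 1 \<and> a i j = 1 then 1 else 0)) \<and>
     (\<forall>z<n. S z = 1 \<longrightarrow> r z < card {j. j < n \<and> S j = 1}) \<and>
     (\<forall>z<n. S z = 1 \<and> z \<noteq> vf \<longrightarrow> vi z < m \<and> a (vi z) z = 1 \<and> fr (vi z) < n \<and> S (fr (vi z)) = 1 \<and>
        l1 (vi z) + l2 (fr (vi z)) = w (vi z) (fr (vi z)) \<and> r (fr (vi z)) < r z)"

text \<open>The minimum is encoded as an attained lower bound. The column that attains it is the one
  that picking a row with slack 0 has to find.\<close>

definition slacks ::
  "(nat \<Rightarrow> real) \<Rightarrow> (nat \<Rightarrow> real) \<Rightarrow> (nat \<Rightarrow> nat) \<Rightarrow> (nat \<Rightarrow> nat) \<Rightarrow> (nat \<Rightarrow> real) \<Rightarrow> bool" where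
  "slacks l1 l2 S T sl \<longleftrightarrow> (\<forall>i<m. T i = 0 \<longrightarrow>
     (\<forall>j<n. S j = 1 \<longrightarrow> sl i \<le> l1 i + l2 j - w i j) \<and>
     (\<exists>j<n. S j = 1 \<and> sl i = l1 i + l2 j - w i j))"

section \<open>Degrees and double counting of edges\<close>

lemma row_set:
  assumes "j < n"
  shows "row (\<lambda>i' j'. if i' = u \<and> j' = j then c else a i' j') i + (if i = u then a u j else 0)
    = row a i + (if i = u then c else 0)"
  using sum_fun_upd[of "{..<n}" j c "a u"] assms by (auto simp: row_def)

lemma col_set:
  assumes "u < m"
  shows "col (\<lambda>i' j'. if i' = u \<and> j' = z then c else a i' j') j + (if j = z then a u z else 0)
    = col a j + (if j = z then c else 0)"
  using sum_fun_upd[of "{..<m}" u c "\<lambda>i. a i z"] assms by (auto simp: col_def)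

lemma total_eq_cols: "total a = (\<Sum>j<n. col a j)"
  unfolding total_def row_def col_def by (rule sum.swap)

lemma entry_le_row: "j < n \<Longrightarrow> a i j \<le> row a i"
  unfolding row_def by (rule member_le_sum_nat) auto

lemma entries_le_row: "j < n \<Longrightarrow> k < n \<Longrightarrow> j \<noteq> k \<Longrightarrow> a i j + a i k \<le> row a i"
  unfolding row_def by (rule two_members_le_sum_nat) auto

lemma row_pos_D: "0 < row a i \<Longrightarrow> \<exists>j<n. 0 < a i j"
  unfolding row_def by (metis gr0I lessThan_iff less_not_refl sum.neutral)

lemma tight_matching_row: "tight_matching a l1 l2 \<Longrightarrow> i < m \<Longrightarrow> row a i \<le> 1"
  by (simp add: tight_matching_def)

lemma tight_matching_unique:
  assumes "tight_matching a l1 l2" "i < m" "j < n" "k < n" "a i j = 1" "a i k = 1"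
  shows "j = k"
  using entries_le_row[of j k a i] tight_matching_row[OF assms(1,2)] assms by fastforce

lemma tight_matching_entry: "tight_matching a l1 l2 \<Longrightarrow> i < m \<Longrightarrow> j < n \<Longrightarrow> a i j = 0 \<or> a i j = 1"
  using entry_le_row[of j a i] tight_matching_row[of a l1 l2 i] by fastforce

lemma total_le: "tight_matching a l1 l2 \<Longrightarrow> total a \<le> m"
  using sum_bounded_above[of "{..<m}" "row a" 1] by (simp add: total_def tight_matching_def)

text \<open>If all columns were full, counting edges by columns would give \<open>m\<close>. Rows
  have degree at most 1, so all \<open>m\<close> of them would have degree exactly 1 and the
  matching would be perfect.\<close>

lemma exists_free_column:
  assumes "tight_matching a l1 l2" "\<not> perfect a"
  shows "\<exists>j<n. col a j \<noteq> mu j"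
proof (rule ccontr)
  assume "\<not> ?thesis"
  then have eq: "\<forall>j<n. col a j = mu j" by blast
  then have "(\<Sum>i<m. row a i) = m" using total_eq_cols[of a] sum_mu by (simp add: total_def)
  moreover obtain i where i: "i < m" "row a i \<noteq> 1" using assms(2) eq by (auto simp: perfect_def)
  then have "(\<Sum>i<m. row a i) < (\<Sum>i<m. 1)"
    using assms(1) by (intro sum_strict_mono_ex1) (auto simp: tight_matching_def le_eq_less_or_eq)
  ultimately show False by simp
qed

text \<open>The root \<open>vf\<close> is not full, so there are fewer than \<open>m\<close> edges
  and some row has degree 0. Such a row is matched to no column of \<open>S\<close>.\<close>

lemma exists_free_row:
  assumes "tight_matching a l1 l2" "tree a l1 l2 vf S fr vi r T"
  shows "\<exists>i<m. T i = 0"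
proof -
  have "(\<Sum>j<n. col a j) < (\<Sum>j<n. mu j)"
    using assms by (intro sum_strict_mono_ex1) (auto simp: tree_def tight_matching_def)
  then have "total a < m" using total_eq_cols sum_mu by simp
  have "\<exists>i<m. row a i = 0"
  proof (rule ccontr)
    assume "\<not> ?thesis"
    then have "(\<Sum>i<m. 1) \<le> (\<Sum>i<m. row a i)" by (intro sum_mono) (auto simp: Suc_le_eq)
    with \<open>total a < m\<close> show False by (simp add: total_def)
  qed
  then obtain i where i: "i < m" "row a i = 0" by blast
  then have "a i j \<noteq> 1" if "j < n" for j using entry_le_row[OF that, of a i] by simp
  with i assms(2) show ?thesis by (auto simp: tree_def)
qed

section \<open>Flipping an augmenting path\<close>

text \<open>
  The situation halfway along the augmenting path: the path has been flipped from the free row \<open>v1\<close> up to the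
  column \<open>z\<close>, which temporarily has one edge too many, and the columns closer to the root are
  still untouched.
\<close>

definition augmented_to ::
  "(nat \<Rightarrow> nat \<Rightarrow> nat) \<Rightarrow> (nat \<Rightarrow> real) \<Rightarrow> (nat \<Rightarrow> real) \<Rightarrow> nat \<Rightarrow> (nat \<Rightarrow> nat) \<Rightarrow> (nat \<Rightarrow> nat) \<Rightarrow>
    (nat \<Rightarrow> nat) \<Rightarrow> nat \<Rightarrow> nat \<Rightarrow> (nat \<Rightarrow> nat \<Rightarrow> nat) \<Rightarrow> bool" where
  "augmented_to a l1 l2 vf S vi r v1 z b \<longleftrightarrow> z < n \<and> S z = 1 \<and>
     (\<forall>i<m. row b i = row a i + (if i = v1 then 1 else 0)) \<and>
     (\<forall>j<n. col b j = col a j + (if j = z then 1 else 0)) \<and>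
     (\<forall>i<m. \<forall>j<n. b i j = 1 \<longrightarrow> l1 i + l2 j = w i j) \<and>
     (\<forall>z'<n. S z' = 1 \<and> z' \<noteq> vf \<and> r z' \<le> r z \<longrightarrow> b (vi z') z' = 1)"

lemma augmented_to_start:
  assumes a: "tight_matching a l1 l2" and t: "tree a l1 l2 vf S fr vi r T"
    and v1: "v1 < m" "row a v1 = 0" and z: "z < n" "S z = 1" "l1 v1 + l2 z = w v1 z"
    and b: "b = (\<lambda>i j. if i = v1 \<and> j = z then 1 else a i j)"
  shows "augmented_to a l1 l2 vf S vi r v1 z b"
proof -
  have 0: "a v1 j = 0" if "j < n" for j using entry_le_row[OF that, of a v1] v1 by simp
  have "row b i = row a i + (if i = v1 then 1 else 0)" for i
    using row_set[OF z(1), of v1 1 a i] 0[OF z(1)] by (cases "i = v1") (simp_all add: b)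
  moreover have "col b j = col a j + (if j = z then 1 else 0)" for j
    using col_set[OF v1(1), of z 1 a j] 0[OF z(1)] by (cases "j = z") (simp_all add: b)
  ultimately show ?thesis
    using z a t 0 by (auto simp: augmented_to_def tight_matching_def tree_def b)
qed

text \<open>The row \<open>vi z\<close> exchanges its edge to the overfull column \<open>z\<close>
  for one to \<open>fr (vi z)\<close>: its degree is unchanged and the surplus moves towards the
  root. Since \<open>vi z\<close> has only one edge, it is not the \<open>vi\<close> of any column
  of smaller rank, so the edges still ahead on the walk survive.\<close>

lemma augmented_to_step:
  assumes a: "tight_matching a l1 l2" and t: "tree a l1 l2 vf S fr vi r T" and v1: "row a v1 = 0"
    and b: "augmented_to a l1 l2 vf S vi r v1 z b" and z: "z \<noteq> vf"
  shows "vi z < m" "fr (vi z) < n" "fr (vi z) \<noteq> z" "b (vi z) z = 1" "b (vi z) (fr (vi z)) = 0"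
    "r (fr (vi z)) < r z"
    "b' = (\<lambda>i j. if i = vi z \<and> j = fr (vi z) then 1 else if i = vi z \<and> j = z then 0 else b i j) \<Longrightarrow>
     augmented_to a l1 l2 vf S vi r v1 (fr (vi z)) b'"
proof -
  let ?u = "vi z" and ?z = "fr (vi z)"
  have S: "z < n" "S z = 1" using b by (auto simp: augmented_to_def)
  then have T: "?u < m" "a ?u z = 1" "?z < n" "S ?z = 1" "l1 ?u + l2 ?z = w ?u ?z" "r ?z < r z"
    using t z by (auto simp: tree_def)
  have "1 \<le> row a ?u" using entry_le_row[OF S(1), of a ?u] T by simp
  then have uv: "?u \<noteq> v1" using v1 by auto
  have bz: "b ?u z = 1" using b S z by (auto simp: augmented_to_def)
  have ne: "?z \<noteq> z" using T by auto
  have "row b ?u \<le> 1" using b T uv tight_matching_row[OF a] by (auto simp: augmented_to_def)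
  then have bz': "b ?u j = 0" if "j < n" "j \<noteq> z" for j
    using entries_le_row[OF that(1) S(1) that(2), of b ?u] bz by simp
  show "vi z < m" "fr (vi z) < n" "fr (vi z) \<noteq> z" "b (vi z) z = 1" "b (vi z) (fr (vi z)) = 0"
    "r (fr (vi z)) < r z" using T ne bz bz' by auto
  assume b': "b' = (\<lambda>i j. if i = vi z \<and> j = fr (vi z) then 1 else if i = vi z \<and> j = z then 0
    else b i j)"
  \<comment> \<open>The exchange is split into a deletion, giving \<open>c\<close>, followed by an
    insertion, so that \<open>row_set\<close> and \<open>col_set\<close> treat one entry at a
    time.\<close>
  define c where "c = (\<lambda>i j. if i = vi z \<and> j = z then 0 else b i j)"
  have b'c: "b' = (\<lambda>i j. if i = ?u \<and> j = ?z then 1 else c i j)" by (auto simp: b' c_def fun_eq_iff)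
  have cz: "c ?u ?z = 0" using bz' T ne by (simp add: c_def)
  have "row b' i = row b i" for i
    using row_set[OF S(1), of ?u 0 b i] row_set[OF T(3), of ?u 1 c i] bz cz
    by (auto simp: b'c c_def[symmetric] split: if_splits)
  moreover have "col b' j + (if j = z then 1 else 0) = col b j + (if j = ?z then 1 else 0)" for j
    using col_set[OF T(1), of z 0 b j] col_set[OF T(1), of ?z 1 c j] bz cz
    by (auto simp: b'c c_def[symmetric] split: if_splits)
  then have "col b' j = col a j + (if j = ?z then 1 else 0)" if "j < n" for j
  proof -
    have "col b j = col a j + (if j = z then 1 else 0)" using b that by (simp add: augmented_to_def)
    moreover have "col b' j + (if j = z then 1 else 0) = col b j + (if j = ?z then 1 else 0)" by fact
    ultimately show ?thesis by linarith
  qed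
  moreover have "b' (vi z') z' = 1" if z': "z' < n" "S z' = 1" "z' \<noteq> vf" "r z' \<le> r ?z" for z'
  proof -
    have "b (vi z') z' = 1" using b z' T by (auto simp: augmented_to_def)
    moreover from this have "vi z' \<noteq> ?u" using bz'[OF z'(1)] z'(4) T by fastforce
    ultimately show ?thesis by (simp add: b')
  qed
  moreover have "l1 i + l2 j = w i j" if ij: "i < m" "j < n" "b' i j = 1" for i j
  proof (cases "i = ?u \<and> j = ?z")
    case True
    then show ?thesis using T by simp
  next
    case False
    then have "b i j = 1" using ij(3) by (simp add: b' split: if_splits)
    then show ?thesis using b ij by (simp add: augmented_to_def)
  qed
  moreover have "\<forall>i<m. row b i = row a i + (if i = v1 then 1 else 0)" using b
    by (simp add: augmented_to_def)
  ultimately show "augmented_to a l1 l2 vf S vi r v1 ?z b'"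
    unfolding augmented_to_def using T(3,4) by (intro conjI allI impI; (elim conjE)?; simp only:)
qed

text \<open>The root had spare capacity and \<open>v1\<close> had no edge, so at the root the
  surplus is absorbed and all degree bounds hold again.\<close>

lemma augmented_to_finish:
  assumes a: "tight_matching a l1 l2" and t: "tree a l1 l2 vf S fr vi r T"
    and v1: "v1 < m" "row a v1 = 0" and b: "augmented_to a l1 l2 vf S vi r v1 vf b"
  shows "tight_matching b l1 l2" "total b = total a + 1"
proof -
  have r: "row b i = row a i + (if i = v1 then 1 else 0)" if "i < m" for i
    using b that by (auto simp: augmented_to_def)
  show "tight_matching b l1 l2"
    using a b t v1 unfolding tight_matching_def augmented_to_def tree_def by auto
  have "total b = (\<Sum>i<m. row a i + (if i = v1 then 1 else 0))" unfolding total_def using r by auto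
  also have "\<dots> = total a + 1" using v1 by (simp add: sum.distrib total_def)
  finally show "total b = total a + 1" .
qed

section \<open>Growing the alternating tree\<close>

text \<open>\<open>fr\<close> and \<open>vi\<close> are arbitrary, as they may hold leftovers of an
  earlier search: when \<open>S\<close> consists of the root alone, no column has a parent.\<close>

lemma tree_start:
  assumes "tight_matching a l1 l2" "vf < n" "col a vf \<noteq> mu vf"
    and S: "\<And>j. j < n \<Longrightarrow> S j = (if j = vf then 1 else 0)"
    and T: "\<And>i. i < m \<Longrightarrow> T i = (if a i vf = 1 then 1 else 0)"
  shows "tree a l1 l2 vf S fr vi (\<lambda>_. 0) T" "card {j. j < n \<and> S j = 1} = 1"
proof -
  have S1: "S j = 1 \<longleftrightarrow> j = vf" if "j < n" for j using S[OF that] by simp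
  then have "{j. j < n \<and> S j = 1} = {vf}" using assms(2) by blast
  then show c: "card {j. j < n \<and> S j = 1} = 1" by simp
  have "(\<exists>j<n. S j = 1 \<and> a i j = 1) \<longleftrightarrow> a i vf = 1" for i
    using assms(2) S1 by blast
  moreover have "col a vf < mu vf" using assms by (auto simp: tight_matching_def le_eq_less_or_eq)
  ultimately show "tree a l1 l2 vf S fr vi (\<lambda>_. 0) T"
    using assms(2) T S1 unfolding tree_def c by simp
qed

lemma slacks_start:
  assumes "vf < n" and S: "\<And>j. j < n \<Longrightarrow> S j = (if j = vf then 1 else 0)"
    and sl: "\<And>i. i < m \<Longrightarrow> T i = 0 \<Longrightarrow> sl i = l1 i + l2 vf - w i vf"
  shows "slacks l1 l2 S T sl"
proof -
  have "S j = 1 \<longleftrightarrow> j = vf" if "j < n" for j using S[OF that] by simp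
  with assms(1) sl show ?thesis unfolding slacks_def by (metis order_refl)
qed

lemma tree_matched_not_in_S:
  assumes "tree a l1 l2 vf S fr vi r T" "v1 < m" "T v1 = 0" "z < n" "a v1 z = 1"
  shows "S z \<noteq> 1"
  using assms by (auto simp: tree_def split: if_splits)

text \<open>The parent of a picked row is stored before it is known whether the row is free. This
  cannot damage the tree: a row that is the \<open>vi\<close> of a column of \<open>S\<close> is
  matched to that column and hence lies in \<open>T\<close>.\<close>

lemma tree_from_update:
  assumes "tree a l1 l2 vf S fr vi r T" "v1 < m" "T v1 = 0"
  shows "tree a l1 l2 vf S (\<lambda>i. if i = v1 then z else fr i) vi r T"
proof -
  have "vi x \<noteq> v1" if "x < n" "S x = 1" "x \<noteq> vf" for x
    using tree_matched_not_in_S[OF assms, of x] that assms(1) by (auto simp: tree_def)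
  then show ?thesis using assms(1) unfolding tree_def by auto
qed

text \<open>The new column receives the old size of \<open>S\<close> as its rank. That is above all
  earlier ranks, in particular above the rank of its parent \<open>fr v1\<close>, and still below
  the new size.\<close>

lemma tree_extend:
  assumes a: "tight_matching a l1 l2" and t: "tree a l1 l2 vf S fr vi r T"
    and v1: "v1 < m" "T v1 = 0" and z: "z < n" "a v1 z = 1"
    and fr: "fr v1 < n" "S (fr v1) = 1" "l1 v1 + l2 (fr v1) = w v1 (fr v1)"
    and S': "S' = (\<lambda>j. if j = z then 1 else S j)" and vi': "vi' = (\<lambda>j. if j = z then v1 else vi j)"
    and T': "\<And>i. i < m \<Longrightarrow> T' i = (if a i z = 1 then 1 else T i)"
  shows "tree a l1 l2 vf S' fr vi' (\<lambda>j. if j = z then card {j. j < n \<and> S j = 1} else r j) T'"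
    and "card {j. j < n \<and> S' j = 1} = Suc (card {j. j < n \<and> S j = 1})"
proof -
  have nS: "S z \<noteq> 1" by (rule tree_matched_not_in_S[OF t v1 z])
  have "{j. j < n \<and> S' j = 1} = insert z {j. j < n \<and> S j = 1}" using z by (auto simp: S')
  then show c: "card {j. j < n \<and> S' j = 1} = Suc (card {j. j < n \<and> S j = 1})" using nS by simp
  have T: "(if a i z = 1 then 1 else T i) = (if \<exists>j<n. S' j = 1 \<and> a i j = 1 then 1 else (0::nat))" if
    "i < m" for i
    using t that z unfolding tree_def S' by auto
  have nz: "x \<noteq> z" if "S x = 1" for x using nS that by auto
  show "tree a l1 l2 vf S' fr vi' (\<lambda>j. if j = z then card {j. j < n \<and> S j = 1} else r j) T'"
    unfolding tree_def c
  proof (intro conjI allI impI)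
    fix i assume "i < m"
    show "T' i = (if \<exists>j<n. S' j = 1 \<and> a i j = 1 then 1 else 0)" using T' T \<open>i < m\<close> by simp
  next
    fix x assume "x < n" "S' x = 1"
    then show "(if x = z then card {j. j < n \<and> S j = 1} else r x) < Suc (card {j. j < n \<and> S j = 1})"
      using t unfolding tree_def S' by (cases "x = z") (auto simp: less_Suc_eq)
  next
    fix x assume x: "x < n" "S' x = 1 \<and> x \<noteq> vf"
    have *: "vi' x < m \<and> a (vi' x) x = 1 \<and> fr (vi' x) < n \<and> S (fr (vi' x)) = 1 \<and>
        l1 (vi' x) + l2 (fr (vi' x)) = w (vi' x) (fr (vi' x)) \<and>
        r (fr (vi' x)) < (if x = z then card {j. j < n \<and> S j = 1} else r x)"
    proof (cases "x = z")
      case True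
      then show ?thesis using t v1 z fr unfolding tree_def by (simp add: vi')
    next
      case False
      then show ?thesis using t x unfolding tree_def by (simp add: vi' S')
    qed
    then have "fr (vi' x) \<noteq> z" using nz by blast
    with * show "vi' x < m" "a (vi' x) x = 1" "fr (vi' x) < n" "S' (fr (vi' x)) = 1"
      "l1 (vi' x) + l2 (fr (vi' x)) = w (vi' x) (fr (vi' x))"
      "(if fr (vi' x) = z then card {j. j < n \<and> S j = 1} else r (fr (vi' x)))
        < (if x = z then card {j. j < n \<and> S j = 1} else r x)"
      by (simp_all add: S')
  next
    show "vf < n" "S' vf = 1" "col a vf < mu vf" using t by (simp_all add: tree_def S')
  qed
qed

lemma slacks_extend:
  assumes "slacks l1 l2 S T sl"
    and S': "S' = (\<lambda>j. if j = z then 1 else S j)" and "z < n"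
    and T': "\<And>i. i < m \<Longrightarrow> T' i = 0 \<Longrightarrow> T i = 0"
    and "\<And>i. i < m \<Longrightarrow> T' i = 0 \<Longrightarrow> sl' i = min (l1 i + l2 z - w i z) (sl i)"
  shows "slacks l1 l2 S' T' sl'"
  unfolding slacks_def
proof (intro allI impI)
  fix i assume i: "i < m" "T' i = 0"
  then have *: "sl' i = min (l1 i + l2 z - w i z) (sl i)" and "T i = 0" using assms by auto
  then have sl: "\<And>j. j < n \<Longrightarrow> S j = 1 \<Longrightarrow> sl i \<le> l1 i + l2 j - w i j"
      and "\<exists>j<n. S j = 1 \<and> sl i = l1 i + l2 j - w i j"
    using i(1) assms(1) unfolding slacks_def by blast+
  then obtain k where k: "k < n" "S k = 1" "sl i = l1 i + l2 k - w i k" by blast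
  have "\<exists>j<n. S' j = 1 \<and> sl' i = l1 i + l2 j - w i j"
  proof (cases "l1 i + l2 z - w i z \<le> sl i")
    case True
    then show ?thesis using * \<open>z < n\<close> by (intro exI[of _ z]) (simp add: S')
  next
    case False
    then show ?thesis using * k by (intro exI[of _ k]) (simp add: S')
  qed
  moreover have "sl' i \<le> l1 i + l2 j - w i j" if "j < n" "S' j = 1" for j
    using * sl[OF that(1)] that(2) by (cases "j = z") (auto simp: S' min_le_iff_disj)
  ultimately show "(\<forall>j<n. S' j = 1 \<longrightarrow> sl' i \<le> l1 i + l2 j - w i j) \<and>
     (\<exists>j<n. S' j = 1 \<and> sl' i = l1 i + l2 j - w i j)" by blast
qed

text \<open>The initial pseudo-matching once the rows below \<open>k\<close> have been treated; \<open>d\<close> holds the column degrees.\<close>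

definition partial_init ::
  "nat \<Rightarrow> (nat \<Rightarrow> nat \<Rightarrow> nat) \<Rightarrow> (nat \<Rightarrow> nat) \<Rightarrow> (nat \<Rightarrow> real) \<Rightarrow> (nat \<Rightarrow> real) \<Rightarrow> bool" where
  "partial_init k a d l1 l2 \<longleftrightarrow> (\<forall>i<m. row a i \<le> (if i < k then 1 else 0)) \<and>
     (\<forall>j<n. col a j = d j \<and> d j \<le> mu j) \<and>
     (\<forall>i<m. \<forall>j<n. a i j = 1 \<longrightarrow> l1 i + l2 j = w i j)"

lemma partial_init_skip:
  assumes "partial_init k a d l1 l2"
  shows "partial_init (Suc k) a d l1 l2"
proof -
  have "row a i \<le> (if i < Suc k then 1 else 0)" if "i < m" for i
  proof -
    have "row a i \<le> (if i < k then 1 else 0)" using assms that by (simp add: partial_init_def)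
    then show ?thesis by (simp split: if_splits)
  qed
  then show ?thesis using assms unfolding partial_init_def by blast
qed

lemma partial_init_add:
  assumes i: "partial_init k a d l1 l2" and k: "k < m" and z: "z < n" "d z < mu z" "l1 k + l2 z = w k z"
  shows "partial_init (Suc k) (\<lambda>i j. if i = k \<and> j = z then 1 else a i j)
    (\<lambda>j. if j = z then Suc (d z) else d j) l1 l2"
proof -
  let ?b = "\<lambda>i j. if i = k \<and> j = z then 1 else a i j"
  have "row a k \<le> (if k < k then 1 else 0)" using i k unfolding partial_init_def by blast
  then have r: "row a k = 0" by simp
  then have 0: "a k z = 0" using entry_le_row[OF z(1), of a k] by simp
  have "row ?b i \<le> (if i < Suc k then 1 else 0)" if "i < m" for i
    using row_set[OF z(1), of k 1 a i] 0 i that r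
    by (cases "i = k") (auto simp: partial_init_def less_Suc_eq)
  moreover have "col ?b j = (if j = z then Suc (d z) else d j) \<and>
      (if j = z then Suc (d z) else d j) \<le> mu j" if "j < n" for j
    using col_set[OF k, of z 1 a j] 0 i that z by (cases "j = z") (auto simp: partial_init_def)
  ultimately show ?thesis using i z unfolding partial_init_def by simp
qed

section \<open>The label update\<close>

context
  fixes a l1 l2 vf S fr vi r T sl \<alpha> l1' l2' sl'
  assumes a: "tight_matching a l1 l2" and t: "tree a l1 l2 vf S fr vi r T" and s: "slacks l1 l2 S T sl"
    and \<alpha>: "\<And>i. i < m \<Longrightarrow> T i = 0 \<Longrightarrow> \<alpha> \<le> sl i" "\<exists>i<m. T i = 0 \<and> \<alpha> = sl i"
    and l1': "\<And>i. i < m \<Longrightarrow> l1' i = (if T i = 1 then l1 i + \<alpha> else l1 i)"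
    and l2': "\<And>j. j < n \<Longrightarrow> l2' j = (if S j = 1 then l2 j - \<alpha> else l2 j)"
    and sl': "\<And>i. i < m \<Longrightarrow> T i = 0 \<Longrightarrow> sl' i = sl i - \<alpha>"
begin

lemma in_T_iff: "i < m \<Longrightarrow> T i = 1 \<longleftrightarrow> (\<exists>j<n. S j = 1 \<and> a i j = 1)"
  and T_cases: "i < m \<Longrightarrow> T i = 0 \<or> T i = 1"
  using t by (simp_all add: tree_def)

text \<open>The reason why matched edges stay tight: on such an edge the shifts of the two labels
  either both occur, and cancel, or both are absent. One direction uses that a row has a single
  mate.\<close>

lemma relabel_matched:
  assumes "i < m" "j < n" "a i j = 1"
  shows "T i = 1 \<longleftrightarrow> S j = 1"
proof
  assume "T i = 1"
  then obtain k where "k < n" "S k = 1" "a i k = 1"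
    using in_T_iff[OF assms(1)] by blast
  then show "S j = 1" using tight_matching_unique[OF a assms(1,2) _ assms(3)] by blast
next
  assume "S j = 1"
  with assms show "T i = 1" using in_T_iff[OF assms(1)] by blast
qed

lemma relabel_alpha_nonneg: "0 \<le> \<alpha>"
proof -
  obtain i where i: "i < m" "T i = 0" "\<alpha> = sl i" using \<alpha> by auto
  with s obtain j where "j < n" "sl i = l1 i + l2 j - w i j" by (auto simp: slacks_def)
  with i a show ?thesis by (auto simp: tight_matching_def)
qed

text \<open>The label sum drops only for a column of \<open>S\<close> and a row outside
  \<open>T\<close>. There it drops by \<alpha>, which is at most the slack of the row. All other
  sums stay or grow because \<alpha> is nonnegative.\<close>

lemma tight_matching_relabel: "tight_matching a l1' l2'"
proof -
  have "w i j \<le> l1' i + l2' j" if ij: "i < m" "j < n" for i j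
  proof (cases "S j = 1 \<and> T i \<noteq> 1")
    case True
    then have "T i = 0" using T_cases[OF ij(1)] by blast
    then have "\<alpha> \<le> l1 i + l2 j - w i j" using True \<alpha>(1)[OF ij(1)] s ij by (fastforce simp: slacks_def)
    then show ?thesis using True ij by (simp add: l1' l2')
  next
    case False
    have "w i j \<le> l1 i + l2 j" using a ij by (auto simp: tight_matching_def)
    then show ?thesis using False relabel_alpha_nonneg ij by (auto simp: l1' l2')
  qed
  moreover have "l1' i + l2' j = w i j" if ij: "i < m" "j < n" "a i j = 1" for i j
    using relabel_matched[OF ij] a ij by (auto simp: l1' l2' tight_matching_def)
  ultimately show ?thesis using a by (auto simp: tight_matching_def)
qed

lemma tree_relabel: "tree a l1' l2' vf S fr vi r T"
proof -
  have "l1' (vi z) + l2' (fr (vi z)) = w (vi z) (fr (vi z))"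
    if z: "z < n" "S z = 1 \<and> z \<noteq> vf" for z
  proof -
    have *: "vi z < m" "a (vi z) z = 1" "fr (vi z) < n" "S (fr (vi z)) = 1"
      "l1 (vi z) + l2 (fr (vi z)) = w (vi z) (fr (vi z))" using t z by (auto simp: tree_def)
    moreover have "T (vi z) = 1" using relabel_matched[OF *(1) z(1) *(2)] z by simp
    ultimately show ?thesis by (simp add: l1' l2')
  qed
  then show ?thesis using t unfolding tree_def by simp
qed

lemma slacks_relabel: "slacks l1' l2' S T sl'"
  unfolding slacks_def
proof (intro allI impI)
  fix i assume i: "i < m" "T i = 0"
  then have "l1' i = l1 i" "sl' i = sl i - \<alpha>" by (simp_all add: l1' sl')
  moreover have "l2' j = l2 j - \<alpha>" if "j < n" "S j = 1" for j using that by (simp add: l2')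
  ultimately have eq: "(l1' i + l2' j - w i j) - sl' i = (l1 i + l2 j - w i j) - sl i"
    if "j < n" "S j = 1" for j using that by simp
  have s1: "sl i \<le> l1 i + l2 j - w i j" if "j < n" "S j = 1" for j
    using s i that by (simp add: slacks_def)
  obtain k where k: "k < n" "S k = 1" "sl i = l1 i + l2 k - w i k"
    using s i unfolding slacks_def by blast
  have "sl' i = l1' i + l2' k - w i k" using eq[OF k(1,2)] k(3) by simp
  moreover have "sl' i \<le> l1' i + l2' j - w i j" if "j < n" "S j = 1" for j
    using eq[OF that] s1[OF that] by linarith
  ultimately show "(\<forall>j<n. S j = 1 \<longrightarrow> sl' i \<le> l1' i + l2' j - w i j) \<and>
     (\<exists>j<n. S j = 1 \<and> sl' i = l1' i + l2' j - w i j)"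
    using k(1,2) by blast
qed

end

section \<open>Optimality by linear programming duality\<close>

lemma perfect_matching:
  assumes a: "tight_matching a l1 l2" and p: "perfect a"
    and M: "M = {(i, j). i < m \<and> j < n \<and> a i j = 1}"
  shows "perfect_pseudo_matching m n mu M"
proof -
  have 1: "card {j. j < n \<and> a i j = 1} = row a i" if "i < m" for i
  proof -
    have "row a i = (\<Sum>j<n. if a i j = 1 then 1 else 0)"
      unfolding row_def using tight_matching_entry[OF a that] by (intro sum.cong) auto
    then show ?thesis by (simp add: sum.If_cases Int_def)
  qed
  have 2: "card {i. i < m \<and> a i j = 1} = col a j" if "j < n" for j
  proof -
    have "col a j = (\<Sum>i<m. if a i j = 1 then 1 else 0)"
      unfolding col_def using tight_matching_entry[OF a _ that] by (intro sum.cong) auto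
    then show ?thesis by (simp add: sum.If_cases Int_def)
  qed
  show ?thesis
    using p 1 2 unfolding perfect_pseudo_matching_def pseudo_matching_def perfect_def M by auto
qed

text \<open>The constant \<open>c\<close> may be any real number. The rows of a feasible matrix sum
  to 1, so the objective is \<open>c\<close> minus the weight divided by \<open>m\<close>, and
  minimising cost is maximising weight.\<close>

lemma perfect_optimal:
  assumes a: "tight_matching a l1 l2" and p: "perfect a"
    and M: "M = {(i, j). i < m \<and> j < n \<and> a i j = 1}"
    and w: "\<And>i j. i < m \<Longrightarrow> j < n \<Longrightarrow> w i j = c - C i j"
  shows "optimal_matrix m n mu C (incidence_matrix M)"
proof -
  let ?X = "incidence_matrix M"
  have X: "?X i j = real (a i j)" if "i < m" "j < n" for i j
    using that tight_matching_entry[OF a that] by (auto simp: incidence_matrix_def M)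
  have "?X \<in> feasible_matrices m n mu"
  proof -
    have "(\<Sum>j<n. ?X i j) = 1" if "i < m" for i
    proof -
      have "(\<Sum>j<n. ?X i j) = real (row a i)" using X that by (simp add: row_def)
      then show ?thesis using p that by (simp add: perfect_def)
    qed
    moreover have "(\<Sum>i<m. ?X i j) = mu j" if "j < n" for j
    proof -
      have "(\<Sum>i<m. ?X i j) = real (col a j)" using X that by (simp add: col_def)
      then show ?thesis using p that by (simp add: perfect_def)
    qed
    ultimately show ?thesis by (auto simp: feasible_matrices_def incidence_matrix_def)
  qed
  define D where "D = (\<Sum>i<m. l1 i) + (\<Sum>j<n. mu j * l2 j)"
  \<comment> \<open>The label sum is determined by the row and column sums of \<open>Y\<close>, so
    it is the same for all feasible matrices.\<close>
  have dual: "(\<Sum>i<m. \<Sum>j<n. Y i j * (l1 i + l2 j)) = D" if "Y \<in> feasible_matrices m n mu" for Y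
  proof -
    have "(\<Sum>i<m. \<Sum>j<n. Y i j * (l1 i + l2 j)) =
      (\<Sum>i<m. (\<Sum>j<n. Y i j) * l1 i) + (\<Sum>i<m. \<Sum>j<n. Y i j * l2 j)"
      by (simp add: algebra_simps sum.distrib sum_distrib_left)
    also have "(\<Sum>i<m. \<Sum>j<n. Y i j * l2 j) = (\<Sum>j<n. (\<Sum>i<m. Y i j) * l2 j)"
      by (subst sum.swap) (simp add: sum_distrib_right)
    finally show ?thesis using that by (simp add: feasible_matrices_def D_def)
  qed
  have obj: "objective m n C Y = c - (\<Sum>i<m. \<Sum>j<n. Y i j * w i j) / m"
    if "Y \<in> feasible_matrices m n mu" for Y
  proof -
    have "(\<Sum>i<m. \<Sum>j<n. Y i j * w i j) = (\<Sum>i<m. (\<Sum>j<n. Y i j) * c) - (\<Sum>i<m. \<Sum>j<n. Y i j * C i j)"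
    proof -
      have "(\<Sum>i<m. \<Sum>j<n. Y i j * w i j) = (\<Sum>i<m. \<Sum>j<n. Y i j * c - Y i j * C i j)"
        using w by (intro sum.cong) (auto simp: right_diff_distrib)
      then show ?thesis by (simp add: sum_subtractf sum_distrib_right)
    qed
    also have "(\<Sum>i<m. (\<Sum>j<n. Y i j) * c) = m * c" using that by (simp add: feasible_matrices_def)
    finally have "(\<Sum>i<m. \<Sum>j<n. Y i j * C i j) = m * c - (\<Sum>i<m. \<Sum>j<n. Y i j * w i j)" by simp
    moreover have "objective m n C Y = (\<Sum>i<m. \<Sum>j<n. Y i j * C i j) / m"
      by (simp add: objective_def sum_divide_distrib)
    ultimately show ?thesis using n_pos n_le_m by (simp add: field_simps)
  qed
  \<comment> \<open>Complementary slackness: wherever the incidence matrix is 1, the edge is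
    tight.\<close>
  have "(\<Sum>i<m. \<Sum>j<n. ?X i j * w i j) = (\<Sum>i<m. \<Sum>j<n. ?X i j * (l1 i + l2 j))"
    using a by (intro sum.cong) (auto simp: incidence_matrix_def M tight_matching_def)
  then have XD: "(\<Sum>i<m. \<Sum>j<n. ?X i j * w i j) = D" using dual \<open>?X \<in> _\<close> by simp
  have "objective m n C ?X \<le> objective m n C Y" if Y: "Y \<in> feasible_matrices m n mu" for Y
  proof -
    have "(\<Sum>i<m. \<Sum>j<n. Y i j * w i j) \<le> (\<Sum>i<m. \<Sum>j<n. Y i j * (l1 i + l2 j))"
      using a Y by (intro sum_mono mult_left_mono) (auto simp: tight_matching_def feasible_matrices_def, fastforce)
    then show ?thesis using dual[OF Y] XD obj Y \<open>?X \<in> _\<close> by (simp add: divide_right_mono)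
  qed
  then show ?thesis using \<open>?X \<in> _\<close> by (auto simp: optimal_matrix_def is_arg_min_linorder)
qed

end

section \<open>The procedures of the algorithm\<close>

text \<open>For an arbitrary pick only the set of candidates matters, so the order and multiplicity
  of the entries of the list are forgotten.\<close>

definition cands :: "state \<Rightarrow> nat set" where
  "cands s = (\<lambda>k. nval s ''cand'' [k]) ` {..<nval s ''cnt'' []}"

lemma cands_nupdate [simp]:
    "x \<noteq> ''cnt'' \<Longrightarrow> x \<noteq> ''cand'' \<Longrightarrow> cands (nupdate x is k s) = cands s"
  and cands_rupdate [simp]: "cands (rupdate x is r s) = cands s"
  and cands_reset [simp]: "cands (nupdate ''cnt'' [] 0 s) = {}"
  and cands_add [simp]: "nval s ''cnt'' [] = k \<Longrightarrow>
    cands (nupdate ''cnt'' [] (Suc k) (nupdate ''cand'' [k] y s)) = insert y (cands s)"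
  by (auto simp: cands_def lessThan_Suc)

lemma cands_frame: "frame A B s t \<Longrightarrow> ''cnt'' \<notin> A \<Longrightarrow> ''cand'' \<notin> A \<Longrightarrow> cands t = cands s"
  by (simp add: cands_def frame_nval)

lemma cands_empty_iff: "cands s = {} \<longleftrightarrow> nval s ''cnt'' [] = 0"
  by (auto simp: cands_def)

lemma cand_in_cands: "r < nval s ''cnt'' [] \<Longrightarrow> nval s ''cand'' [r] \<in> cands s"
  by (auto simp: cands_def)

lemma mods_procedures [simp]:
  "nmods start_tree = {''r'', ''vfree'', ''j'', ''S'', ''i'', ''T''}" "rmods start_tree = {''slack''}"
  "nmods list_tight = {''cnt'', ''i'', ''cand''}" "rmods list_tight = {}"
  "nmods update_labels = {''found'', ''i'', ''j''}"
    "rmods update_labels = {''alpha'', ''l2'', ''l1'', ''slack''}"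
  "nmods pick_tight = {''r'', ''v1'', ''cnt'', ''j'', ''cand'', ''from''}" "rmods pick_tight = {}"
  "nmods compute_status = {''perfect'', ''i'', ''deg1'', ''j'', ''cnt'', ''deg2'', ''cand''}"
  "rmods compute_status = {}"
  "nmods compute_weights = {''i'', ''j''}" "rmods compute_weights = {''cmax'', ''w''}"
  "nmods init_labels = {''i'', ''j''}" "rmods init_labels = {''l1'', ''l2''}"
  "nmods init_matching = {''j'', ''deg2'', ''i'', ''M'', ''cnt'', ''cand'', ''r'', ''z''}"
    "rmods init_matching = {}"
  by (auto simp: start_tree_def add_matched_to_T_def list_tight_def update_labels_def pick_tight_def
      compute_status_def compute_weights_def init_labels_def init_matching_def)

lemma Collect_less_Suc:
  "{i'. i' < Suc i \<and> P i'} = (if P i then insert i {i'. i' < i \<and> P i'} else {i'. i' < i \<and> P i'})"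
  by (auto simp: less_Suc_eq)

lemma all_less_Suc: "(\<forall>i'<Suc i. P i') \<longleftrightarrow> (\<forall>i'<i. P i') \<and> P i"
  by (auto simp: less_Suc_eq)

text \<open>The constant is existential because the optimal matrices are the same for every
  constant. Accordingly, the loops computing \<open>cmax\<close> carry a trivial invariant and are
  only charged for their cost.\<close>

lemma ensures_compute_weights:
  assumes "nval s ''m'' [] = m" "nval s ''n'' [] = n" "1 \<le> m" "1 \<le> n"
  shows "ensures (\<lambda>t. \<exists>c. \<forall>i<m. \<forall>j<n. rval t ''w'' [i, j] = c - rval s ''C'' [i, j])
    compute_weights s (200 * (m * n))"
proof -
  have mn: "m \<le> m * n" "n \<le> m * n" "1 \<le> m * n" using assms(3,4) by auto
  show ?thesis
    unfolding compute_weights_def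
  proof (rule ensures_Seq_frame[where P = "\<lambda>_. True" and
        ?B1.0 = "m * (n * 40 + 17) + 20" and ?B2.0 = "m * (n * 40 + 17) + 7"], goal_cases)
    case 1
    show ?case
    proof (rule ensures_Seq_wp, unfold wp.simps, rule ensures_For[where k = m and B = "n * 40 + 7" and
          I = "\<lambda>_ _. True"], goal_cases)
      case (6 i t)
      note [simp] = frame_nval[OF 6(4)]
      show ?case
      proof (rule ensures_For_le[where k = n and B = 30 and I = "\<lambda>_ _. True"], goal_cases)
        case (6 j v)
        then show ?case by (intro ensures_wp_le) simp_all
      qed (use assms in simp_all)
    qed (use assms in \<open>simp_all add: algebra_simps\<close>)
  next
    case 2
    show ?case using mn by (simp only: algebra_simps)
  next
    case (3 u)
    note [simp] = frame_nval[OF 3(2)] frame_rval[OF 3(2)]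
    define c where "c = rval u ''cmax'' []"
    have "ensures (\<lambda>t. \<forall>i<m. \<forall>j<n. rval t ''w'' [i, j] = c - rval s ''C'' [i, j])
      (FOR ''i'' TO V ''m'' DO
        FOR ''j'' TO V ''n'' DO
          ''w''\<lbrace>V ''i'', V ''j''\<rbrace> ::= R ''cmax'' -\<^sub>r ''C''\<lbrace>V ''i'', V ''j''\<rbrace>) u (m * (n * 40 + 7 + 10) + 7)"
    proof (rule ensures_For[where k = m and B = "n * 40 + 7" and
          I = "\<lambda>i t. \<forall>i'<i. \<forall>j<n. rval t ''w'' [i', j] = c - rval s ''C'' [i', j]"], goal_cases)
      case (6 i t)
      note [simp] = frame_nval[OF 6(4)] frame_rval[OF 6(4)]
      show ?case
      proof (rule ensures_For_le[where k = n and B = 30 and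
            I = "\<lambda>j v. (\<forall>i'<i. \<forall>j<n. rval v ''w'' [i', j] = c - rval s ''C'' [i', j]) \<and>
              (\<forall>j'<j. rval v ''w'' [i, j'] = c - rval s ''C'' [i, j'])"], goal_cases)
        case (6 j v)
        note [simp] = frame_nval[OF 6(4)] frame_rval[OF 6(4)]
        show ?case
          by (rule ensures_wp_le) (use 6 \<open>nval t ''i'' [] = i\<close> in \<open>simp_all add: all_less_Suc c_def\<close>)
      qed (use 6 assms in \<open>simp_all add: all_less_Suc\<close>)
    qed (use assms in simp_all)
    then show ?case by (rule ensures_mono) (auto simp: algebra_simps)
  qed
qed

section \<open>Initialisation and node status\<close>

context matching_problem
begin

lemma m_pos: "1 \<le> m" and m_mn: "m \<le> m * n" and n_mn: "n \<le> m * n" and one_mn: "1 \<le> m * n"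
  using n_pos n_le_m by (auto simp: Suc_le_eq)

text \<open>The cells that stay fixed once the weights are known; from then on \<open>C\<close> is
  no longer read.\<close>

definition env :: "state \<Rightarrow> bool" where
  "env s \<longleftrightarrow> nval s ''m'' [] = m \<and> nval s ''n'' [] = n \<and> (\<forall>j<n. nval s ''mu'' [j] = mu j) \<and>
     (\<forall>i<m. \<forall>j<n. rval s ''w'' [i, j] = w i j)"

lemma env_frame:
  assumes "env s" "frame A B s t" "''m'' \<notin> A" "''n'' \<notin> A" "''mu'' \<notin> A" "''w'' \<notin> B"
  shows "env t"
  using assms frame_nval[OF assms(2)] frame_rval[OF assms(2)] by (simp add: env_def)

lemma ensures_list_tight:
  assumes "env s"
  shows "ensures (\<lambda>t. cands t = {i. i < m \<and> nval s ''T'' [i] = 0 \<and> rval s ''slack'' [i] = 0})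
    list_tight s (60 * m)"
  unfolding list_tight_def
proof (rule ensures_Seq_wp, unfold wp.simps, rule ensures_For[where k = m and B = 30 and
        I = "\<lambda>i t. cands t = {i'. i' < i \<and> nval s ''T'' [i'] = 0
          \<and> rval s ''slack'' [i'] = 0}"], goal_cases)
  case (6 i t)
  note [simp] = frame_nval[OF 6(4)] frame_rval[OF 6(4)]
  show ?case
    by (rule ensures_wp_le) (use 6 in \<open>simp_all add: Collect_less_Suc\<close>)
qed (use assms m_pos in \<open>simp_all add: env_def\<close>)

lemma ensures_compute_status:
  assumes "env s"
  shows "ensures (\<lambda>t. (\<forall>i<m. nval t ''deg1'' [i] = row (\<lambda>i j. nval s ''M'' [i, j]) i) \<and>
      nval t ''perfect'' [] = (if perfect (\<lambda>i j. nval s ''M'' [i, j]) then 1 else 0) \<and>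
      cands t = {j. j < n \<and> col (\<lambda>i j. nval s ''M'' [i, j]) j \<noteq> mu j})
    compute_status s (300 * (m * n))"
proof -
  let ?M = "\<lambda>i j. nval s ''M'' [i, j]"
  let ?J1 = "\<lambda>i t. (\<forall>i'<i. nval t ''deg1'' [i'] = row ?M i') \<and>
    nval t ''perfect'' [] = (if \<forall>i'<i. row ?M i' = 1 then 1 else 0)"
  let ?J2 = "\<lambda>j t. cands t = {j'. j' < j \<and> col ?M j' \<noteq> mu j'} \<and>
    nval t ''perfect'' [] = (if (\<forall>i<m. row ?M i = 1) \<and> (\<forall>j'<j. col ?M j' = mu j') then 1 else 0)"
  have rows: "ensures (?J1 m)
     (''perfect'' ::=\<^sub>n N 1;;
      FOR ''i'' TO V ''m'' DO
        (''deg1''\<langle>V ''i''\<rangle> ::= N 0;;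
         FOR ''j'' TO V ''n'' DO
           ''deg1''\<langle>V ''i''\<rangle> ::= ''deg1''\<langle>V ''i''\<rangle> +\<^sub>n ''M''\<langle>V ''i'', V ''j''\<rangle>;;
         WHEN Not (''deg1''\<langle>V ''i''\<rangle> =\<^sub>n N 1) DO
           ''perfect'' ::=\<^sub>n N 0)) s (m * (n * 30 + 60) + 10)"
  proof (rule ensures_Seq_wp, unfold wp.simps,
      rule ensures_For[where k = m and B = "n * 30 + 50" and I = ?J1], goal_cases)
    case (6 i t)
    note [simp] = frame_nval[OF 6(4)]
    \<comment> \<open>The inner loop writes to \<open>deg1\<close>, which the frame treats as a
      whole; the invariant has to preserve the entries of the other rows itself.\<close>
    let ?P = "\<lambda>j u. nval u ''deg1'' [i] = (\<Sum>j'<j. ?M i j') \<and>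
      (\<forall>i'. i' \<noteq> i \<longrightarrow> nval u ''deg1'' [i'] = nval t ''deg1'' [i'])"
    show ?case
    proof (rule ensures_Seq_frame[where P = "?P n" and ?B1.0 = "n * 30 + 20" and
      ?B2.0 = 20], goal_cases)
      case 1
      show ?case
      proof (rule ensures_Seq_wp, unfold wp.simps,
          rule ensures_For[where k = n and B = 20 and I = ?P], goal_cases)
        case (6 j u)
        note [simp] = frame_nval[OF 6(4)]
        show ?case by (rule ensures_wp_le) (use 6 \<open>nval t ''i'' [] = i\<close> in simp_all)
      qed (use assms 6 in \<open>simp_all add: env_def\<close>)
    next
      case (3 u)
      note [simp] = frame_nval[OF 3(2)]
      show ?case
        by (rule ensures_wp_le) (use 3 6 in \<open>simp_all add: all_less_Suc row_def\<close>)
    qed simp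
  qed (use assms in \<open>simp_all add: env_def algebra_simps\<close>)
  show ?thesis
    unfolding compute_status_def
  proof (rule ensures_Seq_frame[where P = "\<lambda>t. ?J1 m t \<and> cands t = {}" and
        ?B1.0 = "m * (n * 30 + 60) + 20" and ?B2.0 = "n * (m * 30 + 90) + 10"], goal_cases)
    case 1
    show ?case
    proof (rule ensures_Seq_frame[OF rows, where ?B2.0 = 2], goal_cases)
      case (2 t)
      then show ?case by (intro ensures_wp_le) simp_all
    qed simp
  next
    case 2
    show ?case using m_mn n_mn one_mn by (simp only: algebra_simps)
  next
    case (3 u)
    note [simp] = frame_nval[OF 3(2)]
    have "ensures (\<lambda>t. ?J1 m u \<and> ?J2 n t)
     (FOR ''j'' TO V ''n'' DO
        (''deg2''\<langle>V ''j''\<rangle> ::= N 0;;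
         FOR ''i'' TO V ''m'' DO
           ''deg2''\<langle>V ''j''\<rangle> ::= ''deg2''\<langle>V ''j''\<rangle> +\<^sub>n ''M''\<langle>V ''i'', V ''j''\<rangle>;;
         WHEN Not (''deg2''\<langle>V ''j''\<rangle> =\<^sub>n ''mu''\<langle>V ''j''\<rangle>) DO
           (''perfect'' ::=\<^sub>n N 0;;
            ''cand''\<langle>V ''cnt''\<rangle> ::= V ''j'';;
            ''cnt'' ::=\<^sub>n V ''cnt'' +\<^sub>n N 1))) u (n * (m * 30 + 70 + 10) + 7)"
    proof (rule ensures_For[where k = n and B = "m * 30 + 70" and I = ?J2], goal_cases)
      case (6 j t)
      note [simp] = frame_nval[OF 6(4)]
      let ?P = "\<lambda>i u. nval u ''deg2'' [j] = (\<Sum>i'<i. ?M i' j)"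
      show ?case
      proof (rule ensures_Seq_frame[where P = "?P m" and ?B1.0 = "m * 30 + 20" and
        ?B2.0 = 40], goal_cases)
        case 1
        show ?case
        proof (rule ensures_Seq_wp, unfold wp.simps,
            rule ensures_For[where k = m and B = 20 and I = ?P], goal_cases)
          case (6 i v)
          note [simp] = frame_nval[OF 6(4)]
          show ?case by (rule ensures_wp_le) (use 6 \<open>nval t ''j'' [] = j\<close> in simp_all)
        qed (use assms 6 in \<open>simp_all add: env_def\<close>)
      next
        case (3 v)
        note [simp] = frame_nval[OF 3(2)] cands_frame[OF 3(2)]
        show ?case
          by (rule ensures_wp_le) (use 3 6 assms
            in \<open>simp_all add: all_less_Suc Collect_less_Suc col_def env_def\<close>)
      qed simp
    qed (use 3 assms in \<open>simp_all add: env_def algebra_simps\<close>)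
    then show ?case
    proof (rule ensures_frame_mono, goal_cases)
      case (1 t)
      note [simp] = frame_nval[OF 1(2)]
      from 1 3(1) show ?case by (simp add: perfect_def)
    qed (simp add: algebra_simps)
  qed
qed

text \<open>With zero column labels, feasibility says that \<open>l1\<close> dominates each row of
  the weights. Tightness of matched edges is secured later, by the test made when the initial
  matching is built.\<close>

lemma ensures_init_labels:
  assumes "env s"
  shows "ensures (\<lambda>t. (\<forall>j<n. rval t ''l2'' [j] = 0) \<and> (\<forall>i<m. \<forall>j<n. w i j \<le> rval t ''l1'' [i]))
    init_labels s (200 * (m * n))"
  unfolding init_labels_def
proof (rule ensures_Seq_frame[where P = "\<lambda>t. \<forall>j<n. rval t ''l2'' [j] = 0" and
      ?B1.0 = "n * 20 + 7" and ?B2.0 = "m * (n * 40 + 50) + 7"], goal_cases)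
  case 1
  show ?case
  proof (rule ensures_For_le[where k = n and B = 10 and I =
    "\<lambda>j t. \<forall>j'<j. rval t ''l2'' [j'] = 0"], goal_cases)
    case (6 j t)
    then show ?case by (intro ensures_wp_le) (simp_all add: all_less_Suc)
  qed (use assms in \<open>simp_all add: env_def\<close>)
next
  case 2
  show ?case using m_mn n_mn one_mn by (simp only: algebra_simps)
next
  case (3 u)
  note [simp] = frame_nval[OF 3(2)] frame_rval[OF 3(2)]
  have "ensures (\<lambda>t. \<forall>i<m. \<forall>j<n. w i j \<le> rval t ''l1'' [i])
   (FOR ''i'' TO V ''m'' DO
        (''l1''\<lbrace>V ''i''\<rbrace> ::= ''w''\<lbrace>V ''i'', N 0\<rbrace>;;
         FOR ''j'' TO V ''n'' DO
           (WHEN ''l1''\<lbrace>V ''i''\<rbrace> <\<^sub>r ''w''\<lbrace>V ''i'', V ''j''\<rbrace> DO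
             ''l1''\<lbrace>V ''i''\<rbrace> ::= ''w''\<lbrace>V ''i'', V ''j''\<rbrace>))) u (m * (n * 40 + 40 + 10) + 7)"
  proof (rule ensures_For[where k = m and B = "n * 40 + 40" and
        I = "\<lambda>i t. \<forall>i'<i. \<forall>j<n. w i' j \<le> rval t ''l1'' [i']"], goal_cases)
    case (6 i t)
    note [simp] = frame_nval[OF 6(4)] frame_rval[OF 6(4)]
    show ?case
    proof (rule ensures_Seq_wp, unfold wp.simps, rule ensures_For[where k = n and B = 30 and
          I = "\<lambda>j v. (\<forall>j'<j. w i j' \<le> rval v ''l1'' [i]) \<and>
            (\<forall>i'<i. rval v ''l1'' [i'] = rval t ''l1'' [i'])"], goal_cases)
      case (6 j v)
      note [simp] = frame_nval[OF 6(4)] frame_rval[OF 6(4)]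
      show ?case
        by (rule ensures_wp_le) (use 6 assms \<open>i < m\<close> \<open>nval t ''i'' [] = i\<close>
          in \<open>fastforce simp: env_def all_less_Suc\<close>)+
    qed (use assms 6 in \<open>simp_all add: env_def all_less_Suc\<close>)
  qed (use assms in \<open>simp_all add: env_def\<close>)
  then show ?case
  proof (rule ensures_frame_mono, goal_cases)
    case (1 t)
    note [simp] = frame_rval[OF 1(2)]
    from 1 3(1) show ?case by simp
  qed (simp add: algebra_simps)
qed

abbreviation (input) "Mt s \<equiv> \<lambda>i j. nval s ''M'' [i, j]"
abbreviation (input) "L1 s \<equiv> \<lambda>i. rval s ''l1'' [i]"
abbreviation (input) "L2 s \<equiv> \<lambda>j. rval s ''l2'' [j]"
abbreviation (input) "Sv s \<equiv> \<lambda>j. nval s ''S'' [j]"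
abbreviation (input) "Tv s \<equiv> \<lambda>i. nval s ''T'' [i]"
abbreviation (input) "slackv s \<equiv> \<lambda>i. rval s ''slack'' [i]"
abbreviation (input) "fromv s \<equiv> \<lambda>i. nval s ''from'' [i]"
abbreviation (input) "viav s \<equiv> \<lambda>j. nval s ''via'' [j]"

lemma ensures_init_matching:
  assumes "env s" "\<forall>j<n. L2 s j = 0" "\<forall>i<m. \<forall>j<n. w i j \<le> L1 s i"
  shows "ensures (\<lambda>t. tight_matching (Mt t) (L1 t) (L2 t)) init_matching s (500 * (m * n))"
  unfolding init_matching_def
proof (rule ensures_Seq_frame[where P = "\<lambda>t. (\<forall>j<n. nval t ''deg2'' [j] = 0) \<and>
  (\<forall>i<m. \<forall>j<n. Mt t i j = 0)" and
      ?B1.0 = "n * (m * 30 + 40) + 7" and ?B2.0 = "m * (n * 60 + 150) + 7"], goal_cases)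
  case 1
  show ?case
  proof (rule ensures_For_le[where k = n and B = "m * 30 + 30" and
        I = "\<lambda>j t. \<forall>j'<j. nval t ''deg2'' [j'] = 0 \<and> (\<forall>i<m. Mt t i j' = 0)"], goal_cases)
    case (6 j t)
    note [simp] = frame_nval[OF 6(4)]
    show ?case
    proof (rule ensures_Seq_wp, unfold wp.simps, rule ensures_For[where k = m and B = 15 and
          I = "\<lambda>i v. (\<forall>i'<i. Mt v i' j = 0) \<and> (\<forall>j'<j. \<forall>i<m. Mt v i j' = 0)"], goal_cases)
      case (6 i v)
      note [simp] = frame_nval[OF 6(4)]
      show ?case
        by (rule ensures_wp_le) (use 6 \<open>nval t ''j'' [] = j\<close> in \<open>simp_all add: all_less_Suc\<close>)
    next
      case (7 v)
      note [simp] = frame_nval[OF 7(2)]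
      show ?case using 7 6 by (simp add: all_less_Suc)
    qed (use assms 6 in \<open>simp_all add: env_def\<close>)
  qed (use assms in \<open>simp_all add: env_def algebra_simps\<close>)
next
  case 2
  show ?case using m_mn n_mn one_mn by (simp only: algebra_simps)
next
  case (3 u)
  note [simp] = frame_nval[OF 3(2)] frame_rval[OF 3(2)]
  let ?d = "\<lambda>t j. nval t ''deg2'' [j]"
  have "ensures (\<lambda>t. partial_init m (Mt t) (?d t) (L1 s) (L2 s))
    (FOR ''i'' TO V ''m'' DO
        (''cnt'' ::=\<^sub>n N 0;;
         FOR ''j'' TO V ''n'' DO
           (WHEN And (''deg2''\<langle>V ''j''\<rangle> <\<^sub>n ''mu''\<langle>V ''j''\<rangle>)
                     (''l1''\<lbrace>V ''i''\<rbrace> +\<^sub>r ''l2''\<lbrace>V ''j''\<rbrace> =\<^sub>r ''w''\<lbrace>V ''i'', V ''j''\<rbrace>) DO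
             (''cand''\<langle>V ''cnt''\<rangle> ::= V ''j'';;
              ''cnt'' ::=\<^sub>n V ''cnt'' +\<^sub>n N 1));;
         Choose ''r'' (V ''cnt'' +\<^sub>n N 1);;
         WHEN V ''r'' <\<^sub>n V ''cnt'' DO
           (''z'' ::=\<^sub>n ''cand''\<langle>V ''r''\<rangle>;;
            ''M''\<langle>V ''i'', V ''z''\<rangle> ::= N 1;;
            ''deg2''\<langle>V ''z''\<rangle> ::= ''deg2''\<langle>V ''z''\<rangle> +\<^sub>n N 1))) u (m * (n * 60 + 140 + 10) + 7)"
  proof (rule ensures_For[where k = m and B = "n * 60 + 140" and
        I = "\<lambda>i t. partial_init i (Mt t) (?d t) (L1 s) (L2 s)"], goal_cases)
    case 5
    have "row (Mt u) i = 0" if "i < m" for i using 3(1) that by (simp add: row_def)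
    moreover have "col (Mt u) j = 0" if "j < n" for j using 3(1) that by (simp add: col_def)
    ultimately show ?case using 3(1) by (simp add: partial_init_def)
  next
    case (6 i t)
    note [simp] = frame_nval[OF 6(4)] frame_rval[OF 6(4)]
    let ?c = "\<lambda>k. {j. j < k \<and> ?d t j < mu j \<and> L1 s i + L2 s j = w i j}"
    show ?case
    proof (rule ensures_Seq_frame[where P = "\<lambda>v. cands v = ?c n
      \<and> nval v ''r'' [] < Suc (nval v ''cnt'' [])" and
          ?B2.0 = 60 and ?B1.0 = "n * 60 + 50"], goal_cases)
      case 1
      show ?case
      proof (rule ensures_Seq_frame[where P = "\<lambda>v. cands v = ?c n" and ?B1.0 = "n * 60 + 30" and
        ?B2.0 = 10], goal_cases)
        case 1
        show ?case
        proof (rule ensures_Seq_wp, unfold wp.simps, rule ensures_For[where k = n and B = 50 and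
              I = "\<lambda>j v. cands v = ?c j"], goal_cases)
          case (6 j v)
          note [simp] = frame_nval[OF 6(4)] frame_rval[OF 6(4)]
          show ?case
            by (rule ensures_wp_le) (use 6 assms \<open>i < m\<close> \<open>nval t ''i'' [] = i\<close>
              in \<open>simp_all add: Collect_less_Suc env_def\<close>)
        qed (use assms 6 in \<open>simp_all add: env_def\<close>)
      next
        case (3 v)
        then show ?case by (intro ensures_wp_le) simp_all
      qed simp
    next
      case (3 v)
      note [simp] = frame_nval[OF 3(2)]
      have z: "nval v ''cand'' [nval v ''r'' []] \<in> ?c n" if "nval v ''r'' [] < nval v ''cnt'' []"
        using cand_in_cands[OF that] 3(1) by simp
      show ?case
        apply (rule ensures_wp_le)
        using partial_init_skip[OF 6(2)] partial_init_add[OF 6(2,1), unfolded One_nat_def] z 6(3)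
        by simp_all
    qed simp
  qed (use assms in \<open>simp_all add: env_def\<close>)
  then show ?case
  proof (rule ensures_frame_mono, goal_cases)
    case (1 t)
    note [simp] = frame_rval[OF 1(2)]
    from 1(1) assms(2,3) show ?case by (simp add: tight_matching_def partial_init_def)
  qed (simp add: algebra_simps)
qed

section \<open>The steps of one search\<close>

text \<open>The rank \<open>r\<close> is a ghost that no cell stores, so loop invariants quantify it
  existentially. The degrees in \<open>deg1\<close> are included because they decide whether a
  picked row is free.\<close>

definition tree_state :: "(nat \<Rightarrow> nat) \<Rightarrow> state \<Rightarrow> bool" where
  "tree_state r s \<longleftrightarrow> env s \<and> tight_matching (Mt s) (L1 s) (L2 s) \<and>
     tree (Mt s) (L1 s) (L2 s) (nval s ''vfree'' []) (Sv s) (fromv s) (viav s) r (Tv s) \<and>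
     slacks (L1 s) (L2 s) (Sv s) (Tv s) (slackv s) \<and>
     (\<forall>i<m. nval s ''deg1'' [i] = row (Mt s) i)"

definition tree_size :: "state \<Rightarrow> nat" where
  "tree_size s = card {j. j < n \<and> Sv s j = 1}"

lemma ensures_add_matched_to_T:
  assumes "env s" "x \<noteq> ''i''" "x \<noteq> ''T''"
  shows "ensures (\<lambda>t. \<forall>i<m. Tv t i = (if Mt s i (nval s x []) = 1 then 1 else Tv s i))
    (add_matched_to_T (V x)) s (40 * m)"
  unfolding add_matched_to_T_def
proof (rule ensures_For_le[where k = m and B = 20 and
      I = "\<lambda>i t. (\<forall>i'<i. Tv t i' = (if Mt s i' (nval s x []) = 1 then 1 else Tv s i')) \<and>
        (\<forall>i'\<ge>i. Tv t i' = Tv s i')"], goal_cases)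
  case (6 i t)
  note [simp] = frame_nval[OF 6(4)]
  show ?case
    by (rule ensures_wp_le) (use 6 assms in \<open>simp_all add: all_less_Suc\<close>)
qed (use assms m_pos in \<open>simp_all add: env_def\<close>)

lemma tree_state_frame:
  assumes "tree_state r s" "frame A B s t"
    "A \<inter> {''m'', ''n'', ''mu'', ''M'', ''vfree'', ''S'', ''T'', ''from'', ''via'', ''deg1''} = {}"
    "B \<inter> {''w'', ''l1'', ''l2'', ''slack''} = {}"
  shows "tree_state r t"
proof -
  have "env t" using assms env_frame by (auto simp: tree_state_def)
  moreover have "nval t x = nval s x"
    if "x \<in> {''m'', ''n'', ''mu'', ''M'', ''vfree'', ''S'', ''T'', ''from'', ''via'', ''deg1''}" for x
    using frame_nval[OF assms(2)] assms(3) that by blast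
  moreover have "rval t x = rval s x" if "x \<in> {''w'', ''l1'', ''l2'', ''slack''}" for x
    using frame_rval[OF assms(2)] assms(4) that by blast
  ultimately show ?thesis using assms(1) by (simp add: tree_state_def)
qed

lemma ensures_start_tree:
  assumes "env s" "tight_matching (Mt s) (L1 s) (L2 s)" "\<forall>i<m. nval s ''deg1'' [i] = row (Mt s) i"
    and cands: "cands s = {j. j < n \<and> col (Mt s) j \<noteq> mu j}" "cands s \<noteq> {}"
  shows "ensures (\<lambda>t. \<exists>r. tree_state r t \<and> tree_size t = 1) start_tree s (300 * m)"
  unfolding start_tree_def
proof (intro ensures_Seq_assoc, rule ensures_Seq_frame[where P = "\<lambda>t. cands t = cands s
  \<and> nval t ''r'' [] < nval t ''cnt'' []" and
      ?B1.0 = 10 and ?B2.0 = "280 * m"], goal_cases)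
  case 1
  show ?case using cands(2) by (intro ensures_wp_le) (simp_all add: cands_empty_iff)
next
  case 2
  show ?case using m_pos by simp
next
  case (3 s1)
  note [simp] = frame_nval[OF 3(2)] frame_rval[OF 3(2)]
  show ?case
  proof (rule ensures_Seq_frame[where P = "\<lambda>t. nval t ''vfree'' [] \<in> cands s" and ?B1.0 = 10 and
    ?B2.0 = "260 * m"], goal_cases)
    case 1
    show ?case using 3(1) cand_in_cands[of _ s1] by (intro ensures_wp_le) simp_all
  next
    case 2
    show ?case using m_pos by simp
  next
    case (3 s2)
    note [simp] = frame_nval[OF 3(2)] frame_rval[OF 3(2)]
    let ?vf = "nval s2 ''vfree'' []"
    have vf: "?vf < n" "col (Mt s) ?vf \<noteq> mu ?vf" using 3(1) cands(1) by auto
    show ?case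
    proof (rule ensures_Seq_frame[where P = "\<lambda>t. \<forall>j<n. Sv t j = 0" and ?B1.0 = "n * 20 + 7" and
      ?B2.0 = "230 * m"], goal_cases)
      case 1
      show ?case
      proof (rule ensures_For_le[where k = n and B = 10 and I = "\<lambda>j t. \<forall>j'<j. Sv t j' = 0"], goal_cases)
        case (6 j t)
        then show ?case by (intro ensures_wp_le) (simp_all add: all_less_Suc)
      qed (use assms in \<open>simp_all add: env_def\<close>)
    next
      case 2
      show ?case using n_le_m m_pos by simp
    next
      case (3 s3)
      note [simp] = frame_nval[OF 3(2)] frame_rval[OF 3(2)]
      note S = 3(1)
      show ?case
      proof (rule ensures_Seq_frame[where P = "\<lambda>t. \<forall>i<m. Tv t i = 0" and ?B1.0 = "m * 20 + 7" and
        ?B2.0 = "200 * m"], goal_cases)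
        case 1
        show ?case
        proof (rule ensures_For_le[where k = m and B = 10 and I =
          "\<lambda>i t. \<forall>i'<i. Tv t i' = 0"], goal_cases)
          case (6 j t)
          then show ?case by (intro ensures_wp_le) (simp_all add: all_less_Suc)
        qed (use assms in \<open>simp_all add: env_def\<close>)
      next
        case 2
        show ?case using m_pos by simp
      next
        case (3 s4)
        note [simp] = frame_nval[OF 3(2)] frame_rval[OF 3(2)]
        note T = 3(1)
        show ?case
        proof (rule ensures_Seq_frame[where P = "\<lambda>t. \<forall>j<n. Sv t j = (if j = ?vf then 1 else 0)" and
              ?B1.0 = 10 and ?B2.0 = "180 * m"], goal_cases)
          case 1
          show ?case using S by (intro ensures_wp_le) simp_all
        next
          case 2
          show ?case using m_pos by simp
        next
          case (3 s5)
          note [simp] = frame_nval[OF 3(2)] frame_rval[OF 3(2)]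
          note S = 3(1)
          have "env s5" using assms(1) by (simp add: env_def)
          show ?case
          proof (rule ensures_Seq_frame[OF ensures_add_matched_to_T, where ?B2.0 =
            "120 * m"], goal_cases)
            case 1
            show ?case by fact
          next
            case 4
            show ?case using m_pos by simp
          next
            case (5 s6)
            note [simp] = frame_nval[OF 5(2)[unfolded add_matched_to_T_def]] frame_rval[OF 5(2)[unfolded add_matched_to_T_def]]
            have T: "Tv s6 i = (if Mt s i ?vf = 1 then 1 else 0)" if "i < m" for i
              using 5(1) that T by simp
            show ?case
            proof (rule ensures_For_le[where k = m and B = 50 and
                  I = "\<lambda>i t. \<forall>i'<i. Tv s6 i' = 0 \<longrightarrow> slackv t i' = L1 s i' + L2 s ?vf - w i' ?vf"], goal_cases)
              case (6 i t)
              note [simp] = frame_nval[OF 6(4)] frame_rval[OF 6(4)]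
              show ?case
                by (rule ensures_wp_le) (use 6 vf assms(1) in \<open>simp_all add: all_less_Suc env_def\<close>)
            next
              case (7 t)
              note [simp] = frame_nval[OF 7(2)] frame_rval[OF 7(2)]
              have tr: "tree (Mt s) (L1 s) (L2 s) ?vf (Sv s5) (fromv s) (viav s) (\<lambda>_. 0) (Tv s6)"
                "card {j. j < n \<and> Sv s5 j = 1} = 1"
                using tree_start[OF assms(2) vf, of "Sv s5" "Tv s6"] S T by simp_all
              have "slacks (L1 s) (L2 s) (Sv s5) (Tv s6) (slackv t)"
                by (rule slacks_start[OF vf(1)]) (use 7(1) S in simp_all)
              then have "tree_state (\<lambda>_. 0) t" "tree_size t = 1"
                using tr assms by (simp_all add: tree_state_def tree_size_def env_def)
              then show ?case by blast
            next
              case 8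
              show ?case using m_pos by simp
            qed (use assms in \<open>simp_all add: env_def\<close>)
          qed simp_all
        qed
      qed
    qed
  qed
qed

text \<open>The row that attained the minimal slack has slack 0 afterwards; it guarantees that the
  next list of tight rows is nonempty.\<close>

lemma ensures_update_labels:
  assumes s: "tree_state r s"
  shows "ensures (\<lambda>t. tree_state r t \<and> (\<exists>i<m. Tv t i = 0 \<and> slackv t i = 0)) update_labels s (200 * m)"
  unfolding update_labels_def
proof (intro ensures_Seq_assoc, rule ensures_Seq_frame[where P = "\<lambda>t. nval t ''found'' [] = 0" and
      ?B1.0 = 10 and ?B2.0 = "180 * m"], goal_cases)
  case 1
  show ?case by (rule ensures_wp_le) simp_all
next
  case 2
  show ?case using m_pos by simp
next
  case (3 s1)
  note [simp] = frame_nval[OF 3(2)] frame_rval[OF 3(2)]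
  have env: "env s" and a: "tight_matching (Mt s) (L1 s) (L2 s)"
    and t: "tree (Mt s) (L1 s) (L2 s) (nval s ''vfree'' []) (Sv s) (fromv s) (viav s) r (Tv s)"
    and sl: "slacks (L1 s) (L2 s) (Sv s) (Tv s) (slackv s)"
    using s by (simp_all add: tree_state_def)
  define Z where "Z i = slackv s ` {i'. i' < i \<and> Tv s i' = 0}" for i
  have Z_Suc: "Z (Suc i) = (if Tv s i = 0 then insert (slackv s i) (Z i) else Z i)" for i
    unfolding Z_def Collect_less_Suc by simp
  \<comment> \<open>\<open>alpha\<close> is the minimum of the slacks scanned so far.
    \<open>found\<close> marks the time before the first row outside \<open>T\<close>, when
    \<open>alpha\<close> still has arbitrary contents.\<close>
  let ?I = "\<lambda>i t. if nval t ''found'' [] = 0 then Z i = {}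
    else rval t ''alpha'' [] \<in> Z i \<and> (\<forall>x\<in>Z i. rval t ''alpha'' [] \<le> x)"
  show ?case
  proof (rule ensures_Seq_frame[where P = "?I m" and ?B1.0 = "m * 50 + 7" and ?B2.0 =
    "120 * m"], goal_cases)
    case 1
    show ?case
    proof (rule ensures_For_le[where k = m and B = 40 and I = ?I], goal_cases)
      case (6 i t)
      note [simp] = frame_nval[OF 6(4)] frame_rval[OF 6(4)]
      have less: "\<forall>x\<in>Z i. c \<le> x" if "\<forall>x\<in>Z i. d \<le> x" "c < d" for c d
        using that by (meson less_imp_le order_trans)
      show ?case
      proof (cases "Tv s i = 0 \<and> (nval t ''found'' [] = 0 \<or> slackv s i < rval t ''alpha'' [])")
        case True
        then have "\<forall>x\<in>Z i. slackv s i \<le> x" using 6(2) less by (auto split: if_splits)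
        then show ?thesis by (intro ensures_wp_le) (use 6(3) True in \<open>simp_all add: Z_Suc\<close>)
      next
        case False
        then show ?thesis
          by (cases "Tv s i = 0"; intro ensures_wp_le) (use 6(2,3) in \<open>simp_all add: Z_Suc not_less\<close>)
      qed
    qed (use env 3 in \<open>simp_all add: env_def Z_def\<close>)
  next
    case 2
    show ?case using m_pos by simp
  next
    case (3 s2)
    note [simp] = frame_nval[OF 3(2)] frame_rval[OF 3(2)]
    define \<alpha> where "\<alpha> = rval s2 ''alpha'' []"
    have "\<exists>i<m. Tv s i = 0" by (rule exists_free_row[OF a t])
    then have "Z m \<noteq> {}" by (auto simp: Z_def)
    then have "\<alpha> \<in> Z m" "\<forall>x\<in>Z m. \<alpha> \<le> x" using 3(1) by (simp_all add: \<alpha>_def split: if_splits)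
    then have \<alpha>: "\<And>i. i < m \<Longrightarrow> Tv s i = 0 \<Longrightarrow> \<alpha> \<le> slackv s i" "\<exists>i<m. Tv s i = 0 \<and> \<alpha> = slackv s i"
      unfolding Z_def by blast+
    show ?case
    proof (rule ensures_Seq_frame[where P = "\<lambda>t. \<forall>j<n. L2 t j = (if Sv s j = 1 then L2 s j - \<alpha>
      else L2 s j)" and
          ?B1.0 = "n * 40 + 7" and ?B2.0 = "60 * m"], goal_cases)
      case 1
      show ?case
      proof (rule ensures_For_le[where k = n and B = 30 and
            I = "\<lambda>j t. (\<forall>j'<j. L2 t j' = (if Sv s j' = 1 then L2 s j' - \<alpha> else L2 s j')) \<and>
              (\<forall>j'\<ge>j. L2 t j' = L2 s j')"], goal_cases)
        case (6 j t)
        note [simp] = frame_nval[OF 6(4)] frame_rval[OF 6(4)]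
        show ?case
          by (rule ensures_wp_le) (use 6 in \<open>simp_all add: all_less_Suc \<alpha>_def\<close>)
      qed (use env in \<open>simp_all add: env_def\<close>)
    next
      case 2
      show ?case using m_pos n_le_m by simp
    next
      case (3 s3)
      note [simp] = frame_nval[OF 3(2)] frame_rval[OF 3(2)]
      note l2 = 3(1)
      have "ensures (\<lambda>t. \<forall>i<m. L1 t i = (if Tv s i = 1 then L1 s i + \<alpha> else L1 s i) \<and>
          (Tv s i = 0 \<longrightarrow> slackv t i = slackv s i - \<alpha>))
        (FOR ''i'' TO V ''m'' DO
        (IF ''T''\<langle>V ''i''\<rangle> =\<^sub>n N 1
         THEN ''l1''\<lbrace>V ''i''\<rbrace> ::= ''l1''\<lbrace>V ''i''\<rbrace> +\<^sub>r R ''alpha''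
         ELSE ''slack''\<lbrace>V ''i''\<rbrace> ::= ''slack''\<lbrace>V ''i''\<rbrace> -\<^sub>r R ''alpha'')) s3 (m * (40 + 10) + 7)"
      proof (rule ensures_For[where k = m and B = 40 and
            I = "\<lambda>i t. (\<forall>i'<i. L1 t i' = (if Tv s i' = 1 then L1 s i' + \<alpha> else L1 s i') \<and>
          (Tv s i' = 0 \<longrightarrow> slackv t i' = slackv s i' - \<alpha>)) \<and> (\<forall>i'\<ge>i. L1 t i' = L1 s i'
            \<and> slackv t i' = slackv s i')"], goal_cases)
        case (6 i t)
        note [simp] = frame_nval[OF 6(4)] frame_rval[OF 6(4)]
        show ?case
          by (rule ensures_wp_le) (use 6 in \<open>simp_all add: all_less_Suc \<alpha>_def\<close>)
      qed (use env in \<open>simp_all add: env_def\<close>)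
      then show ?case
      proof (rule ensures_frame_mono, goal_cases)
        case (1 t)
        note [simp] = frame_nval[OF 1(2)] frame_rval[OF 1(2)]
        have l1: "\<And>i. i < m \<Longrightarrow> L1 t i = (if Tv s i = 1 then L1 s i + \<alpha> else L1 s i)"
          and l2: "\<And>j. j < n \<Longrightarrow> L2 s3 j = (if Sv s j = 1 then L2 s j - \<alpha> else L2 s j)"
          and sl': "\<And>i. i < m \<Longrightarrow> Tv s i = 0 \<Longrightarrow> slackv t i = slackv s i - \<alpha>"
          using 1(1) l2 by simp_all
        note inst = l1 l2 sl'
        have "tight_matching (Mt s) (L1 t) (L2 s3)"
          by (rule tight_matching_relabel[OF a t sl, where \<alpha> = \<alpha> and sl' = "slackv t"])
            (use \<alpha> inst in blast)+
        moreover have "tree (Mt s) (L1 t) (L2 s3) (nval s ''vfree'' [])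
          (Sv s) (fromv s) (viav s) r (Tv s)"
          by (rule tree_relabel[OF a t sl, where \<alpha> = \<alpha> and sl' = "slackv t"]) (use \<alpha> inst in blast)+
        moreover have "slacks (L1 t) (L2 s3) (Sv s) (Tv s) (slackv t)"
          by (rule slacks_relabel[OF a t sl, where \<alpha> = \<alpha>]) (use \<alpha> inst in blast)+
        moreover have "\<exists>i<m. Tv s i = 0 \<and> slackv t i = 0"
          using \<alpha>(2) sl' by auto
        ultimately have "tree_state r t \<and> (\<exists>i<m. Tv t i = 0 \<and> slackv t i = 0)"
          using s unfolding tree_state_def env_def by simp
        then show ?case .
      qed (use m_pos in simp)
    qed
  qed
qed

definition picked :: "state \<Rightarrow> bool" where
  "picked s \<longleftrightarrow> (let v = nval s ''v1'' []; z = fromv s v in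
     v < m \<and> Tv s v = 0 \<and> z < n \<and> Sv s z = 1 \<and> L1 s v + L2 s z = w v z)"

lemma ensures_pick_tight:
  assumes s: "tree_state r s"
    and cands: "cands s = {i. i < m \<and> Tv s i = 0 \<and> slackv s i = 0}" "cands s \<noteq> {}"
  shows "ensures (\<lambda>t. tree_state r t \<and> picked t) pick_tight s (200 * m)"
  unfolding pick_tight_def
proof (intro ensures_Seq_assoc, rule ensures_Seq_frame[where P = "\<lambda>t. cands t = cands s
  \<and> nval t ''r'' [] < nval t ''cnt'' []" and
      ?B1.0 = 10 and ?B2.0 = "180 * m"], goal_cases)
  case 1
  show ?case using cands(2) by (intro ensures_wp_le) (simp_all add: cands_empty_iff)
next
  case 2
  show ?case using m_pos by simp
next
  case (3 s1)
  note [simp] = frame_nval[OF 3(2)] frame_rval[OF 3(2)]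
  have env: "env s" and t: "tree (Mt s) (L1 s) (L2 s) (nval s ''vfree'' [])
    (Sv s) (fromv s) (viav s) r (Tv s)"
    and sl: "slacks (L1 s) (L2 s) (Sv s) (Tv s) (slackv s)"
    using s by (simp_all add: tree_state_def)
  show ?case
  proof (rule ensures_Seq_frame[where P = "\<lambda>t. nval t ''v1'' [] \<in> cands s" and ?B1.0 = 10 and
    ?B2.0 = "160 * m"], goal_cases)
    case 1
    show ?case using 3(1) cand_in_cands[of _ s1] by (intro ensures_wp_le) simp_all
  next
    case 2
    show ?case using m_pos by simp
  next
    case (3 s2)
    note [simp] = frame_nval[OF 3(2)] frame_rval[OF 3(2)]
    let ?v = "nval s2 ''v1'' []"
    have v: "?v < m" "Tv s ?v = 0" "slackv s ?v = 0" using 3(1) cands by auto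
    let ?c = "\<lambda>k. {j. j < k \<and> Sv s j = 1 \<and> L1 s ?v + L2 s j = w ?v j}"
    \<comment> \<open>The slack 0 of the picked row is attained at some column of \<open>S\<close>,
      so the second \<open>Choose\<close> cannot get stuck.\<close>
    have "?c n \<noteq> {}" using sl v unfolding slacks_def by fastforce
    show ?case
    proof (rule ensures_Seq_frame[where P = "\<lambda>t. cands t = {}" and ?B1.0 = 10 and ?B2.0 =
      "140 * m"], goal_cases)
      case 1
      show ?case by (rule ensures_wp_le) simp_all
    next
      case 2
      show ?case using m_pos by simp
    next
      case (3 s3)
      note [simp] = frame_nval[OF 3(2)] frame_rval[OF 3(2)]
      show ?case
      proof (rule ensures_Seq_frame[where P = "\<lambda>t. cands t = ?c n" and ?B1.0 = "n * 60 + 7" and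
        ?B2.0 = "50 * m"], goal_cases)
        case 1
        show ?case
        proof (rule ensures_For_le[where k = n and B = 50 and I = "\<lambda>j t. cands t = ?c j"], goal_cases)
          case (6 j t)
          note [simp] = frame_nval[OF 6(4)] frame_rval[OF 6(4)]
          show ?case
            by (rule ensures_wp_le) (use 6 env v in \<open>simp_all add: Collect_less_Suc env_def\<close>)
        qed (use env 3 in \<open>simp_all add: env_def\<close>)
      next
        case 2
        show ?case using m_pos n_le_m by simp
      next
        case (3 s4)
        note [simp] = frame_nval[OF 3(2)] frame_rval[OF 3(2)]
        have cnt: "0 < nval s4 ''cnt'' []" using 3(1) \<open>?c n \<noteq> {}\<close> cands_empty_iff[of s4] by (metis gr0I)
        let ?Q = "\<lambda>t. \<exists>z. z < n \<and> Sv s z = 1 \<and> L1 s ?v + L2 s z = w ?v z \<and>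
          fromv t = (\<lambda>i. if i = ?v then z else fromv s i)"
        have "ensures ?Q (Choose ''r'' (V ''cnt'');; ''from''\<langle>V ''v1''\<rangle> ::= ''cand''\<langle>V ''r''\<rangle>) s4 20"
        proof (rule ensures_wp_le)
          have "nval s4 ''cand'' [k] \<in> ?c n" if "k < nval s4 ''cnt'' []" for k
            using cand_in_cands[OF that] 3(1) by simp
          then show "wp (Choose ''r'' (V ''cnt'');; ''from''\<langle>V ''v1''\<rangle> ::= ''cand''\<langle>V ''r''\<rangle>) ?Q s4"
            using cnt by (auto simp: fun_eq_iff)
        qed simp
        then show ?case
        proof (rule ensures_frame_mono, goal_cases)
          case (1 u)
          note [simp] = frame_nval[OF 1(2)] frame_rval[OF 1(2)]
          obtain z where z: "z < n" "Sv s z = 1" "L1 s ?v + L2 s z = w ?v z"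
            "fromv u = (\<lambda>i. if i = ?v then z else fromv s i)" using 1(1) by auto
          have "tree_state r u"
            using s tree_from_update[OF t v(1,2), of z] z(4) by (simp add: tree_state_def env_def)
          moreover have "nval u ''from'' [?v] = z" using fun_cong[OF z(4), of ?v] by simp
          ultimately show ?case using z v by (simp add: picked_def)
        qed (use m_pos in simp)
      qed
    qed
  qed
qed

lemma ensures_augment:
  assumes s: "tree_state r s" "picked s" and free: "nval s ''deg1'' [nval s ''v1'' []] = 0"
  shows "ensures (\<lambda>t. env t \<and> tight_matching (Mt t) (L1 t) (L2 t) \<and> total (Mt t) = Suc (total (Mt s)))
    augment s (200 * m)"
proof -
  let ?v = "nval s ''v1'' []" and ?vf = "nval s ''vfree'' []"
  let ?A = "augmented_to (Mt s) (L1 s) (L2 s) ?vf (Sv s) (viav s) r ?v"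
  have env: "env s" and a: "tight_matching (Mt s) (L1 s) (L2 s)"
    and t: "tree (Mt s) (L1 s) (L2 s) ?vf (Sv s) (fromv s) (viav s) r (Tv s)"
    using s by (simp_all add: tree_state_def)
  have v: "?v < m" and z: "fromv s ?v < n" "Sv s (fromv s ?v) = 1"
    "L1 s ?v + L2 s (fromv s ?v) = w ?v (fromv s ?v)"
    using s(2) by (simp_all add: picked_def Let_def)
  have row: "row (Mt s) ?v = 0" using free s(1) v by (simp add: tree_state_def)
  \<comment> \<open>A free row has only zero entries, so the first flip inserts an edge.\<close>
  have M0: "Mt s ?v (fromv s ?v) = 0" using entry_le_row[OF z(1), of "Mt s" ?v] row by simp
  show ?thesis
    unfolding augment_def
  proof (rule ensures_Seq_frame[where P = "\<lambda>t. ?A (nval t ''z'' []) (Mt t)" and ?B1.0 = 40 and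
    ?B2.0 = "150 * m"], goal_cases)
    case 1
    show ?case
      using M0 augmented_to_start[OF a t v row z HOL.refl, unfolded One_nat_def]
        by (intro ensures_wp_le) simp_all
  next
    case 2
    show ?case using m_pos by simp
  next
    case (3 s1)
    note [simp] = frame_nval[OF 3(2)] frame_rval[OF 3(2)]
    let ?z = "\<lambda>t. nval t ''z'' []"
    have "r (?z s1) < card {j. j < n \<and> Sv s j = 1}" using 3(1) t
      by (simp add: augmented_to_def tree_def)
    also have "\<dots> \<le> card {..<n}" by (intro card_mono) auto
    finally have rn: "r (?z s1) \<le> n" by simp
    show ?case
    proof (rule ensures_mono, rule ensures_While_frame[where I = "\<lambda>t. ?A (?z t) (Mt t)" and
          v = "\<lambda>t. r (?z t)" and k = n and B = 100 and
          Q = "\<lambda>t. env t \<and> tight_matching (Mt t) (L1 t) (L2 t)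
            \<and> total (Mt t) = Suc (total (Mt s))"], goal_cases)
      case (2 u)
      note [simp] = frame_nval[OF 2(2)] frame_rval[OF 2(2)]
      have nz: "?z u \<noteq> ?vf" using 2(3) by simp
      \<comment> \<open>The known entries 1 and 0 turn the two flips into a deletion and an
        insertion, and \<open>fr (vi z) \<noteq> z\<close> keeps them on different cells. The rank
        of the current column is the loop variant.\<close>
      note step = augmented_to_step[OF a t row 2(1) nz]
      show ?case
        by (rule ensures_wp_le) (use step(3-6) step(7)[OF HOL.refl] in \<open>simp_all cong: if_cong\<close>)
    next
      case (3 u)
      note [simp] = frame_nval[OF 3(2)] frame_rval[OF 3(2)]
      have "?A ?vf (Mt u)" using 3(1,3) by simp
      from augmented_to_finish[OF a t v row this] show ?case using env by (simp add: env_def)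
    next
      case 6
      show ?case using m_pos n_le_m by simp
    qed (use 3 rn in simp_all)
  qed
qed

lemma ensures_extend_tree:
  assumes s: "tree_state r s" "picked s" and matched: "nval s ''deg1'' [nval s ''v1'' []] \<noteq> 0"
  shows "ensures (\<lambda>t. (\<exists>r. tree_state r t) \<and> tree_size t = Suc (tree_size s)) extend_tree s (300 * m)"
proof -
  let ?v = "nval s ''v1'' []" and ?vf = "nval s ''vfree'' []"
  have env: "env s" and a: "tight_matching (Mt s) (L1 s) (L2 s)"
    and tr: "tree (Mt s) (L1 s) (L2 s) ?vf (Sv s) (fromv s) (viav s) r (Tv s)"
    and sl: "slacks (L1 s) (L2 s) (Sv s) (Tv s) (slackv s)"
    using s by (simp_all add: tree_state_def)
  have v: "?v < m" "Tv s ?v = 0" and fr: "fromv s ?v < n" "Sv s (fromv s ?v) = 1"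
    "L1 s ?v + L2 s (fromv s ?v) = w ?v (fromv s ?v)"
    using s(2) by (simp_all add: picked_def Let_def)
  have "0 < row (Mt s) ?v" using matched s(1) v by (simp add: tree_state_def)
  then obtain z where "z < n" "0 < Mt s ?v z" using row_pos_D[of "Mt s" ?v] by blast
  then have z: "z < n" "Mt s ?v z = 1" using tight_matching_entry[OF a v(1), of z] by auto
  have other: "Mt s ?v j \<noteq> 1" if "j < n" "j \<noteq> z" for j
    using tight_matching_unique[OF a v(1) that(1) z(1)] that(2) z(2) by blast
  let ?S = "\<lambda>j. if j = z then 1 else Sv s j"
  show ?thesis
    unfolding extend_tree_def
  proof (intro ensures_Seq_assoc, rule ensures_Seq_frame[where P = "\<lambda>t. nval t ''z'' [] = z" and
        ?B1.0 = "n * 30 + 7" and ?B2.0 = "250 * m"], goal_cases)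
    case 1
    show ?case
    \<comment> \<open>The row has exactly one mate, so the cell is written only in round
      \<open>z\<close>; before that its contents are arbitrary.\<close>
    proof (rule ensures_For_le[where k = n and B = 20 and I =
      "\<lambda>j t. z < j \<longrightarrow> nval t ''z'' [] = z"], goal_cases)
      case (6 j t)
      note [simp] = frame_nval[OF 6(4)] frame_rval[OF 6(4)]
      show ?case
        by (cases "j = z"; intro ensures_wp_le) (use 6 other[of j] z in \<open>simp_all add: less_Suc_eq\<close>)
    qed (use env z in \<open>simp_all add: env_def\<close>)
  next
    case 2
    show ?case using m_pos n_le_m by simp
  next
    case (3 s1)
    note [simp] = frame_nval[OF 3(2)] frame_rval[OF 3(2)] 3(1)
    show ?case
    proof (rule ensures_Seq_frame[where P = "\<lambda>t. Sv t = ?S" and ?B1.0 = 20 and ?B2.0 =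
      "220 * m"], goal_cases)
      case 1
      show ?case by (rule ensures_wp_le) (simp_all add: fun_eq_iff)
    next
      case 2
      show ?case using m_pos by simp
    next
      case (3 s2)
      note [simp] = frame_nval[OF 3(2)] frame_rval[OF 3(2)]
      note S = 3(1)
      show ?case
      proof (rule ensures_Seq_frame[where P = "\<lambda>t. viav t = (\<lambda>j. if j = z then ?v else viav s j)" and
            ?B1.0 = 20 and ?B2.0 = "190 * m"], goal_cases)
        case 1
        show ?case by (rule ensures_wp_le) (simp_all add: fun_eq_iff)
      next
        case 2
        show ?case using m_pos by simp
      next
        case (3 s3)
        note [simp] = frame_nval[OF 3(2)] frame_rval[OF 3(2)]
        note via = 3(1)
        show ?case
        proof (rule ensures_Seq_frame[where P = "\<lambda>t. \<forall>i. Tv t i = (if i = ?v then 1 else Tv s i)" and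
              ?B1.0 = 20 and ?B2.0 = "160 * m"], goal_cases)
          case 1
          show ?case by (rule ensures_wp_le) simp_all
        next
          case 2
          show ?case using m_pos by simp
        next
          case (3 s4)
          note [simp] = frame_nval[OF 3(2)] frame_rval[OF 3(2)]
          note T = 3(1)
          have "env s4" using env by (simp add: env_def)
          show ?case
          proof (rule ensures_Seq_frame[OF ensures_add_matched_to_T, where ?B2.0 =
            "110 * m"], goal_cases)
            case 1
            show ?case by fact
          next
            case 4
            show ?case using m_pos by simp
          next
            case (5 s5)
            note [simp] = frame_nval[OF 5(2)[unfolded add_matched_to_T_def]] frame_rval[OF 5(2)[unfolded add_matched_to_T_def]]
            \<comment> \<open>The entry set separately for the picked row is covered by this
              formula, because that row is itself matched to \<open>z\<close>.\<close>
            have T: "Tv s5 i = (if Mt s i z = 1 then 1 else Tv s i)" if "i < m" for i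
              using 5(1) that T z(2) by simp
            let ?s = "\<lambda>i. min (L1 s i + L2 s z - w i z) (slackv s i)"
            show ?case
            proof (rule ensures_For_le[where k = m and B = 70 and
                  I = "\<lambda>i t. (\<forall>i'<i. Tv s5 i' = 0 \<longrightarrow> slackv t i' = ?s i') \<and>
                    (\<forall>i'\<ge>i. slackv t i' = slackv s i')"], goal_cases)
              case (6 i t)
              note [simp] = frame_nval[OF 6(4)] frame_rval[OF 6(4)]
              show ?case
                by (rule ensures_wp_le) (use 6 z env in \<open>simp_all add: all_less_Suc env_def min_def\<close>)
            next
              case (7 t)
              note [simp] = frame_nval[OF 7(2)] frame_rval[OF 7(2)]
              note ext = tree_extend[OF a tr v z fr HOL.refl HOL.refl T]
              have "slacks (L1 s) (L2 s) ?S (Tv s5) (slackv t)"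
              proof (rule slacks_extend[OF sl HOL.refl z(1)])
                fix i assume i: "i < m" "Tv s5 i = 0"
                then show "Tv s i = 0" using T[OF i(1)] by (simp split: if_splits)
                show "slackv t i = ?s i" using 7(1) i by blast
              qed
              then have "tree_state (\<lambda>j. if j = z then card {j. j < n \<and> Sv s j = 1} else r j) t"
                using ext(1) s(1) S via by (simp add: tree_state_def env_def)
              moreover have "tree_size t = Suc (tree_size s)"
                using ext(2) fun_cong[OF S] by (simp add: tree_size_def)
              ultimately show ?case by blast
            next
              case 8
              show ?case using m_pos by simp
            qed (use env in \<open>simp_all add: env_def\<close>)
          qed simp_all
        qed
      qed
    qed
  qed
qed

section \<open>Counting growth steps and searches\<close>

definition status :: "state \<Rightarrow> bool" where
  "status s \<longleftrightarrow> (\<forall>i<m. nval s ''deg1'' [i] = row (Mt s) i) \<and>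
     nval s ''perfect'' [] = (if perfect (Mt s) then 1 else 0) \<and>
     cands s = {j. j < n \<and> col (Mt s) j \<noteq> mu j}"

lemma tree_size_le: "tree_size s \<le> n"
proof -
  have "tree_size s \<le> card {..<n}" unfolding tree_size_def by (intro card_mono) auto
  then show ?thesis by simp
qed

text \<open>The two outcomes feed the variant of the search loop, which falls when \<open>S\<close>
  grows and when the flag is set. The edge count is kept in the first outcome so that the end of a
  search can be compared with its start.\<close>

lemma ensures_search_iteration:
  assumes s: "tree_state r s" and aug: "nval s ''augmented'' [] = 0"
  shows "ensures (\<lambda>t.
      if nval t ''augmented'' [] = 0
      then (\<exists>r. tree_state r t) \<and> total (Mt t) = total (Mt s) \<and> tree_size t = Suc (tree_size s)
      else env t \<and> tight_matching (Mt t) (L1 t) (L2 t) \<and> total (Mt t) = Suc (total (Mt s)))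
    (list_tight;;
     WHEN V ''cnt'' =\<^sub>n N 0 DO
       (update_labels;; list_tight);;
     pick_tight;;
     IF ''deg1''\<langle>V ''v1''\<rangle> =\<^sub>n N 0
     THEN (augment;; ''augmented'' ::=\<^sub>n N 1)
     ELSE extend_tree) s (1200 * m)"
proof (intro ensures_Seq_assoc, rule ensures_Seq_frame[OF ensures_list_tight, where ?B2.0 =
  "1100 * m"], goal_cases)
  case 1
  show ?case using s by (simp add: tree_state_def)
next
  case 2
  show ?case using m_pos by simp
next
  case (3 s1)
  note [simp] = frame_nval[OF 3(2)] frame_rval[OF 3(2)]
  have s1: "tree_state r s1" by (rule tree_state_frame[OF s 3(2)]) simp_all
  let ?tight = "\<lambda>t. {i. i < m \<and> Tv t i = 0 \<and> slackv t i = 0}"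
  show ?case
  \<comment> \<open>Both branches end with a nonempty list: either it was nonempty already, or the
    label update has made a row tight.\<close>
  proof (rule ensures_Seq_frame[where P = "\<lambda>t. tree_state r t \<and> cands t = ?tight t \<and> cands t \<noteq> {}" and
        ?B1.0 = "400 * m" and ?B2.0 = "600 * m"], goal_cases)
    case 1
    show ?case
    proof (rule ensures_If_le[where B = "300 * m"], goal_cases)
      case 1
      show ?case
      proof (rule ensures_Seq_frame[OF ensures_update_labels[OF s1], where ?B2.0 =
        "60 * m"], goal_cases)
        case 1
        show ?case using m_pos by simp
      next
        case (2 t)
        have "env t" using 2(1) by (simp add: tree_state_def)
        show ?case
        proof (rule ensures_frame_mono[OF ensures_list_tight[OF \<open>env t\<close>]], goal_cases)
          case (1 u)
          note [simp] = frame_nval[OF 1(2)] frame_rval[OF 1(2)]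
          have "tree_state r u" by (rule tree_state_frame[OF _ 1(2)]) (use 2(1) in simp_all)
          then show ?case using 1(1) 2(1) by auto
        qed simp
      qed
    next
      case 2
      show ?case by (rule ensures_SKIP) (use 2 s1 3(1) cands_empty_iff[of s1] in simp_all)
    qed (use m_pos in simp_all)
  next
    case 2
    show ?case using m_pos by simp
  next
    case (3 s2)
    note [simp] = frame_nval[OF 3(2)] frame_rval[OF 3(2)]
    show ?case
    proof (rule ensures_Seq_frame[OF ensures_pick_tight[where r = r], where ?B2.0 =
      "350 * m"], goal_cases)
      case 4
      show ?case using m_pos by simp
    next
      case (5 s3)
      note [simp] = frame_nval[OF 5(2)] frame_rval[OF 5(2)]
      show ?case
      proof (rule ensures_If_le[where B = "310 * m"], goal_cases)
        case 1
        with 5(1) have free: "tree_state r s3" "picked s3"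
          "nval s3 ''deg1'' [nval s3 ''v1'' []] = 0" by simp_all
        show ?case
        proof (rule ensures_Seq_frame[OF ensures_augment[OF free], where ?B2.0 = 2], goal_cases)
          case 1
          show ?case using m_pos by simp
        next
          case (2 t)
          show ?case by (rule ensures_wp_le) (use 2(1) in \<open>simp_all add: env_def\<close>)
        qed
      next
        case 2
        with 5(1) have matched: "tree_state r s3" "picked s3"
          "nval s3 ''deg1'' [nval s3 ''v1'' []] \<noteq> 0" by simp_all
        show ?case
        proof (rule ensures_frame_mono[OF ensures_extend_tree[OF matched]], goal_cases)
          case (1 t)
          note [simp] = frame_nval[OF 1(2)[unfolded extend_tree_def add_matched_to_T_def]]
          show ?case using 1(1) aug by (simp add: tree_size_def)
        qed simp
      qed (use m_pos in simp_all)
    qed (use 3(1) in blast)+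
  qed
qed

lemma ensures_search_and_augment:
  assumes s: "env s" "tight_matching (Mt s) (L1 s) (L2 s)" "status s" "\<not> perfect (Mt s)"
  shows "ensures (\<lambda>t. env t \<and> tight_matching (Mt t) (L1 t) (L2 t) \<and> total (Mt t) = Suc (total (Mt s)))
    search_and_augment s (2000 * (m * n))"
  unfolding search_and_augment_def
proof (intro ensures_Seq_assoc, rule ensures_Seq_frame[OF ensures_start_tree[OF s(1,2)], where
      ?B2.0 = "1500 * (m * n)"], goal_cases)
  case 3
  show ?case using s(3) exists_free_column[OF s(2,4)] by (auto simp: status_def)
next
  case 4
  show ?case using m_mn one_mn by linarith
next
  case (5 s1)
  note [simp] = frame_nval[OF 5(2)] frame_rval[OF 5(2)]
  let ?Q = "\<lambda>t. env t \<and> tight_matching (Mt t) (L1 t) (L2 t) \<and> total (Mt t) = Suc (total (Mt s))"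
  let ?I = "\<lambda>t. if nval t ''augmented'' [] = 0 then (\<exists>r. tree_state r t)
    \<and> total (Mt t) = total (Mt s) else ?Q t"
  let ?I1 = "\<lambda>t. nval t ''augmented'' [] = 0 \<and> (\<exists>r. tree_state r t) \<and> total (Mt t) = total (Mt s)
    \<and> tree_size t = 1"
  show ?case
  proof (rule ensures_Seq_frame[where P = ?I1 and ?B1.0 = 2 and ?B2.0 =
    "n * (1200 * m + 5) + 4"], goal_cases)
    case 1
    have *: "tree_state r (nupdate ''augmented'' [] 0 s1)" if "tree_state r s1" for r
      by (rule tree_state_frame[OF that, of "{''augmented''}" "{}"]) (simp_all add: frame_def)
    show ?case by (rule ensures_wp_le) (use 5(1) * in \<open>auto simp: tree_size_def\<close>)
  next
    case 2
    show ?case using m_mn n_mn one_mn by (simp only: algebra_simps)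
  next
    case (3 s2)
    show ?case
    \<comment> \<open>With \<open>Suc n\<close> in place of \<open>n\<close> the variant is still
      positive when \<open>S\<close> contains all columns, so an augmentation decreases it even
      then. It starts at \<open>n\<close> because the initial tree has size 1.\<close>
    proof (rule ensures_mono, rule ensures_While[where I = ?I and Q = ?Q and k = n and
          B = "1200 * m" and v = "\<lambda>t. if nval t ''augmented'' [] = 0 then Suc n - tree_size t
            else 0"], goal_cases)
      case (2 t)
      then obtain r where t: "tree_state r t" "nval t ''augmented'' [] = 0"
        "total (Mt t) = total (Mt s)"
        by auto
      show ?case
      proof (rule ensures_mono[OF ensures_search_iteration[OF t(1,2)]], goal_cases)
        case (1 u)
        then show ?case using t(2,3) tree_size_le[of t] tree_size_le[of u]
          by (cases "nval u ''augmented'' [] = 0") simp_all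
      qed simp
    qed (use 3(1) in \<open>simp_all add: algebra_simps\<close>)
  qed
qed (use s in \<open>simp_all add: status_def\<close>)

lemma ensures_status:
  assumes "env s"
  shows "ensures status compute_status s (300 * (m * n))"
proof (rule ensures_frame_mono[OF ensures_compute_status[OF assms]], goal_cases)
  case (1 t)
  note [simp] = frame_nval[OF 1(2)]
  from 1(1) show ?case by (simp add: status_def)
qed simp

text \<open>A round is charged 2000 units for the search and 300 for recomputing the status, each
  times \<open>m * n\<close>. The rest of the 3000 covers the first status computation and the guard
  tests.\<close>

lemma ensures_main_loop:
  assumes s: "env s" "tight_matching (Mt s) (L1 s) (L2 s)"
  shows "ensures (\<lambda>t. tight_matching (Mt t) (L1 t) (L2 t) \<and> perfect (Mt t))
    (compute_status;; WHILE V ''perfect'' =\<^sub>n N 0 DO (search_and_augment;; compute_status))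
    s (3000 * (m * (m * n)))"
proof (rule ensures_Seq_frame[OF ensures_status[OF s(1)], where ?B2.0 =
  "m * (2300 * (m * n) + 10) + 10"], goal_cases)
  case 1
  have "m * n \<le> m * (m * n)" "m \<le> m * (m * n)" "1 \<le> m * (m * n)"
    using m_pos n_pos by auto
  then show ?case by (simp only: algebra_simps)
next
  case (2 s1)
  note [simp] = frame_nval[OF 2(2)] frame_rval[OF 2(2)]
  let ?I = "\<lambda>t. env t \<and> tight_matching (Mt t) (L1 t) (L2 t) \<and> status t"
  show ?case
  proof (rule ensures_mono, rule ensures_While[where I = ?I and k = m and B = "2300 * (m * n) + 1" and
        Q = "\<lambda>t. tight_matching (Mt t) (L1 t) (L2 t) \<and> perfect (Mt t)" and v =
          "\<lambda>t. m - total (Mt t)"], goal_cases)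
    case 1
    show ?case using s 2(1) by (simp add: env_def)
  next
    case (2 t)
    then have t: "env t" "tight_matching (Mt t) (L1 t) (L2 t)" "status t" "\<not> perfect (Mt t)"
      by (auto simp: status_def)
    show ?case
    proof (rule ensures_Seq_frame[OF ensures_search_and_augment[OF t], where ?B2.0 =
      "300 * (m * n)"], goal_cases)
      case (2 u)
      then have "env u" by blast
      show ?case
      proof (rule ensures_frame_mono[OF ensures_status[OF \<open>env u\<close>]], goal_cases)
        case (1 x)
        note [simp] = frame_nval[OF 1(2)] frame_rval[OF 1(2)]
        \<comment> \<open>The variant \<open>m - total\<close> is a truncated difference; the bound
          after the search makes its decrease strict.\<close>
        have "total (Mt u) \<le> m" using total_le 2(1) by blast
        then show ?case using 1(1) 2(1) by (simp add: env_def)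
      qed simp
    qed simp
  next
    case (3 t)
    then show ?case by (auto simp: status_def split: if_splits)
  qed (simp_all add: algebra_simps)
qed

end

theorem theorem2:
  shows "\<exists>K::nat. \<forall>(m::nat) (n::nat) (mu::nat \<Rightarrow> nat) (C::nat \<Rightarrow> nat \<Rightarrow> real) (s::state).
    0 < n \<and> n \<le> m \<and> (\<forall>j<n. 0 < mu j) \<and> (\<Sum>j<n. mu j) = m \<and> has_input m n mu C s \<longrightarrow>
      \<not> has_infinite_run (modified_hungarian, s) \<and>
      (\<forall>k c' s'. steps (modified_hungarian, s) k (c', s') \<longrightarrow>
         k \<le> K * (m ^ 2 * n) \<and>
         (final (c', s') \<longrightarrow>
            c' = SKIP \<and>
            perfect_pseudo_matching m n mu (output_matching m n s') \<and>
            optimal_matrix m n mu C (incidence_matrix (output_matching m n s'))))"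
proof (intro exI[of _ 4000] allI impI, elim conjE)
  fix m n mu C s
  assume n: "0 < n" "n \<le> m" "(\<Sum>j<n. mu j) = m" and input: "has_input m n mu C s"
  let ?Q = "\<lambda>t. perfect_pseudo_matching m n mu (output_matching m n t) \<and>
    optimal_matrix m n mu C (incidence_matrix (output_matching m n t))"
  have mn: "m * n \<le> m * (m * n)" "1 \<le> m * (m * n)" using n by auto
  \<comment> \<open>The constant collects 200 for the weights, 200 for the labels, 500 for the
    initial matching and 3000 for the main loop, rounded up to cover sequencing. The first three are
    charged per \<open>m * n\<close>, which is at most \<open>m * (m * n)\<close>.\<close>
  have "ensures ?Q modified_hungarian s (4000 * (m * (m * n)))"
    unfolding modified_hungarian_def
  proof (intro ensures_Seq_assoc,
    rule ensures_Seq_frame[OF ensures_compute_weights[where m = m and n = n],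
        where ?B2.0 = "3750 * (m * (m * n))"], goal_cases)
    case 5
    show ?case using mn by linarith
  next
    case (6 s1)
    note [simp] = frame_nval[OF 6(2)] frame_rval[OF 6(2)]
    obtain c where c: "\<forall>i<m. \<forall>j<n. rval s1 ''w'' [i, j] = c - C i j"
      using 6(1) input by (auto simp: has_input_def)
    \<comment> \<open>The constant in the weights is known only after the run has computed it, so
      the locale is instantiated at this point of the run.\<close>
    interpret matching_problem m n mu "\<lambda>i j. c - C i j" by unfold_locales (use n in auto)
    have "env s1" using c input by (simp add: env_def has_input_def)
    show ?case
    proof (rule ensures_Seq_frame[OF ensures_init_labels[OF \<open>env s1\<close>], where ?B2.0 =
      "3520 * (m * (m * n))"], goal_cases)
      case 1
      show ?case using mn by linarith
    next
      case (2 s2)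
      have "env s2" by (rule env_frame[OF \<open>env s1\<close> 2(2)]) simp_all
      show ?case
      proof (rule ensures_Seq_frame[OF ensures_init_matching[OF \<open>env s2\<close>], where ?B2.0 =
        "3000 * (m * (m * n))"], goal_cases)
        case 3
        show ?case using mn by linarith
      next
        case (4 s3)
        have "env s3" by (rule env_frame[OF \<open>env s2\<close> 4(2)]) simp_all
        show ?case
        proof (rule ensures_mono[OF ensures_main_loop[OF \<open>env s3\<close> 4(1)]], goal_cases)
          case (1 t)
          have out: "output_matching m n t = {(i, j). i < m \<and> j < n \<and> nval t ''M'' [i, j] = 1}"
            by (simp add: output_matching_def)
          show ?case
            using perfect_matching[OF _ _ out] perfect_optimal[OF _ _ out HOL.refl] 1 by blast
        qed simp
      qed (use 2(1) in simp_all)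
    qed
  qed (use n input in \<open>simp_all add: has_input_def\<close>)
  moreover have "m * (m * n) = m ^ 2 * n" by (simp add: power2_eq_square)
  ultimately have "ensures ?Q modified_hungarian s (4000 * (m ^ 2 * n))" by metis
  then show "\<not> has_infinite_run (modified_hungarian, s) \<and>
      (\<forall>k c' s'. steps (modified_hungarian, s) k (c', s') \<longrightarrow>
         k \<le> 4000 * (m ^ 2 * n) \<and>
         (final (c', s') \<longrightarrow>
            c' = SKIP \<and>
            perfect_pseudo_matching m n mu (output_matching m n s') \<and>
            optimal_matrix m n mu C (incidence_matrix (output_matching m n s'))))"
    using ensures_no_infinite_run ensures_steps by blast
qed

end
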